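(* Let $T$ be a finite tree that is $L$-DS. Then for every positive integer $m$, the product $T\times K_m$ is $L$-DS.
   Context: All graphs are finite, simple and undirected. The Laplacian matrix of a graph $G$ is $L(G)=D(G)-A(G)$, where $A(G)$ is the adjacency matrix and $D(G)$ the diagonal matrix of vertex degrees; its multiset of eigenvalues is the Laplacian spectrum $\mathrm{Spec}(G)$. Two graphs are $L$-cospectral if they have the same Laplacian spectrum. A graph $G$ is $L$-DS (determined by its Laplacian spectrum) if every graph $L$-cospectral with $G$ is isomorphic to $G$. For graphs $G_1,G_2$ with disjoint vertex sets, the product $G_1\times G_2$ is the disjoint union $G_1+G_2$ together with all edges joining a vertex of $G_1$ to a vertex of $G_2$ (i.e. the join). $K_m$ is the complete graph on $m$ vertices. *)

theory Defs
  imports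
    "HOL-Library.Countable_Set"
    "HOL-Computational_Algebra.Polynomial"
    "Graph_Theory.Graph_Theory"
    "Jordan_Normal_Form.Char_Poly"
begin

text \<open>
  A finite simple undirected graph is a \<open>pair_graph\<close>: a finite vertex set together with a finite
  irreflexive symmetric set of vertex pairs. An undirected edge \<open>uv\<close> is the pair of arcs
  \<open>(u, v)\<close>, \<open>(v, u)\<close>.
\<close>

subsection \<open>Trees\<close>

text \<open>
  The library predicate \<open>tree\<close> cannot be used here: it forbids directed cycles, and in a symmetric
  digraph every edge gives the directed cycle \<open>u, v, u\<close> of length 2. A cycle of an undirected
  graph is a directed cycle of length at least 3. The predicate \<open>connected\<close> includes that there
  is at least one vertex.
\<close>

definition undirected_tree :: "'a pair_pre_digraph \<Rightarrow> bool" where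
  "undirected_tree G \<longleftrightarrow>
     pair_graph G \<and> connected (with_proj G) \<and>
     \<not> (\<exists>p. pre_digraph.cycle (with_proj G) p \<and> 3 \<le> length p)"

subsection \<open>Complete graphs and joins\<close>

definition complete_graph :: "nat \<Rightarrow> nat pair_pre_digraph" where
  "complete_graph m =
     \<lparr> pverts = {..<m}, parcs = {(u, v). u < m \<and> v < m \<and> u \<noteq> v} \<rparr>"

text \<open>The vertex sets are made disjoint by passing to the sum type.\<close>

definition graph_join ::
    "'a pair_pre_digraph \<Rightarrow> 'b pair_pre_digraph \<Rightarrow> ('a + 'b) pair_pre_digraph" where
  "graph_join G H =
     \<lparr> pverts = pverts G <+> pverts H,
       parcs = map_prod Inl Inl ` parcs G \<union> map_prod Inr Inr ` parcs H
         \<union> (Inl ` pverts G) \<times> (Inr ` pverts H) \<union> (Inr ` pverts H) \<times> (Inl ` pverts G) \<rparr>"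

subsection \<open>The Laplacian spectrum\<close>

text \<open>
  The matrices are taken with respect to an enumeration \<open>f\<close> of the vertices by
  \<open>0, \<dots>, n - 1\<close>. In a symmetric digraph the degree of a vertex is its out-degree.
\<close>

definition adjacency_mat :: "(nat \<Rightarrow> 'a) \<Rightarrow> 'a pair_pre_digraph \<Rightarrow> real mat" where
  "adjacency_mat f G = Matrix.mat (card (pverts G)) (card (pverts G))
     (\<lambda>(i, j). if (f i, f j) \<in> parcs G then 1 else 0)"

definition degree_mat :: "(nat \<Rightarrow> 'a) \<Rightarrow> 'a pair_pre_digraph \<Rightarrow> real mat" where
  "degree_mat f G = Matrix.mat (card (pverts G)) (card (pverts G))
     (\<lambda>(i, j). if i = j then real (out_degree (with_proj G) (f i)) else 0)"

definition laplacian_mat :: "(nat \<Rightarrow> 'a) \<Rightarrow> 'a pair_pre_digraph \<Rightarrow> real mat" where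
  "laplacian_mat f G = degree_mat f G - adjacency_mat f G"

text \<open>
  For a finite set \<open>A\<close>, \<open>from_nat_into A\<close> is a bijection from \<open>{..<card A}\<close> to \<open>A\<close>. The spectrum
  does not depend on this choice (lemma \<open>laplacian_spectrum_enum\<close> below). Eigenvalues are counted
  with algebraic multiplicity.
\<close>

definition laplacian_spectrum :: "'a pair_pre_digraph \<Rightarrow> complex multiset" where
  "laplacian_spectrum G =
     proots (char_poly (map_mat complex_of_real (laplacian_mat (from_nat_into (pverts G)) G)))"

definition L_cospectral :: "'a pair_pre_digraph \<Rightarrow> 'b pair_pre_digraph \<Rightarrow> bool" where
  "L_cospectral G H \<longleftrightarrow> laplacian_spectrum G = laplacian_spectrum H"

text \<open>
  A definition cannot quantify over the vertex type of \<open>H\<close>. Every finite graph has an isomorphic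
  copy on natural numbers, so \<open>nat\<close> suffices; lemma \<open>L_DS_any_type\<close> below gives the property for
  graphs on an arbitrary type.
\<close>

definition L_DS :: "'a pair_pre_digraph \<Rightarrow> bool" where
  "L_DS G \<longleftrightarrow>
     (\<forall>H :: nat pair_pre_digraph. pair_graph H \<and> L_cospectral H G \<longrightarrow>
        digraph_iso (with_proj H) (with_proj G))"

subsection \<open>Adequacy of the definitions\<close>

lemma complete_digraph_complete_graph: "complete_digraph m (with_proj (complete_graph m))"
  unfolding complete_digraph_pair_def by (auto simp: complete_graph_def)

lemma pair_graph_complete_graph: "pair_graph (complete_graph m)"
  using complete_digraph_complete_graph pair_graphI_graph unfolding complete_digraph_def by blast

lemma pair_graph_graph_join:
  assumes "pair_graph G" "pair_graph H"
  shows "pair_graph (graph_join G H)"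
proof -
  interpret G: pair_graph G by fact
  interpret H: pair_graph H by fact
  have symG: "(v, u) \<in> parcs G" if "(u, v) \<in> parcs G" for u v
    using that G.pair_sym_arcs by (auto simp: symmetric_def sym_def)
  have symH: "(v, u) \<in> parcs H" if "(u, v) \<in> parcs H" for u v
    using that H.pair_sym_arcs by (auto simp: symmetric_def sym_def)
  show ?thesis
  proof unfold_locales
    fix e assume "e \<in> parcs (graph_join G H)"
    then show "fst e \<in> pverts (graph_join G H)" "snd e \<in> pverts (graph_join G H)"
      "fst e \<noteq> snd e"
      by (auto simp: graph_join_def dest: G.in_arcsD1 G.in_arcsD2 H.in_arcsD1 H.in_arcsD2
          G.no_loops' H.no_loops')
  next
    show "finite (pverts (graph_join G H))" "finite (parcs (graph_join G H))"
      using G.pair_finite_verts H.pair_finite_verts G.pair_finite_arcs H.pair_finite_arcs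
      by (auto simp: graph_join_def)
    have "(y, x) \<in> parcs (graph_join G H)" if "(x, y) \<in> parcs (graph_join G H)" for x y
      using that by (cases x; cases y) (auto simp: graph_join_def dest: symG symH)
    then show "symmetric (with_proj (graph_join G H))"
      by (simp add: symmetric_def sym_def)
  qed
qed

lemma laplacian_mat_reindex:
  assumes f: "bij_betw f {..<card (pverts G)} (pverts G)"
    and g: "bij_betw g {..<card (pverts G)} (pverts G)"
  shows "similar_mat (laplacian_mat f G) (laplacian_mat g G)"
proof -
  define n where "n = card (pverts G)"
  define \<pi> where "\<pi> i = the_inv_into {..<n} g (f i)" for i
  have pi: "bij_betw \<pi> {..<n} {..<n}"
    using bij_betw_trans[OF f bij_betw_the_inv_into[OF g]]
    by (simp add: n_def \<pi>_def[abs_def] comp_def)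
  have gpi: "g (\<pi> i) = f i" if "i < n" for i
    using f g that unfolding \<pi>_def n_def
    by (intro f_the_inv_into_f_bij_betw) (auto simp: bij_betw_def)
  have pi_lt: "\<pi> i < n" if "i < n" for i
    using pi that by (auto simp: bij_betw_def)
  have pi_eq: "\<pi> i = \<pi> j \<longleftrightarrow> i = j" if "i < n" "j < n" for i j
    using pi that by (auto simp: bij_betw_def inj_on_def)
  define P where "P = Matrix.mat n n (\<lambda>(i, j). if j = \<pi> i then 1 else 0 :: real)"
  define Q where "Q = Matrix.mat n n (\<lambda>(i, j). if i = \<pi> j then 1 else 0 :: real)"
  let ?A = "laplacian_mat f G" and ?B = "laplacian_mat g G"
  have dims: "?A \<in> carrier_mat n n" "?B \<in> carrier_mat n n" "P \<in> carrier_mat n n" "Q \<in> carrier_mat n n"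
    by (auto simp: laplacian_mat_def degree_mat_def adjacency_mat_def n_def P_def Q_def)
  have PQ: "P * Q = 1\<^sub>m n"
  proof (rule eq_matI)
    fix i j assume ij: "i < dim_row (1\<^sub>m n :: real mat)" "j < dim_col (1\<^sub>m n :: real mat)"
    then have "(P * Q) $$ (i, j) = (\<Sum>k<n. (if k = \<pi> i then 1 else 0) * (if k = \<pi> j then 1 else 0))"
      by (simp add: P_def Q_def scalar_prod_def lessThan_atLeast0)
    also have "\<dots> = (\<Sum>k<n. if k = \<pi> i then (if \<pi> i = \<pi> j then 1 else 0) else 0)"
      by (intro sum.cong) auto
    also have "\<dots> = (1\<^sub>m n) $$ (i, j)"
      using ij pi_lt[of i] pi_eq[of i j] by (simp add: one_mat_def)
    finally show "(P * Q) $$ (i, j) = (1\<^sub>m n) $$ (i, j)" .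
  qed (use dims in auto)
  then have QP: "Q * P = 1\<^sub>m n"
    using mat_mult_left_right_inverse[OF dims(3,4)] by blast
  have PB: "P * ?B = Matrix.mat n n (\<lambda>(i, j). ?B $$ (\<pi> i, j))"
  proof (rule eq_matI)
    fix i j
    assume "i < dim_row (Matrix.mat n n (\<lambda>(i, j). ?B $$ (\<pi> i, j)))"
      "j < dim_col (Matrix.mat n n (\<lambda>(i, j). ?B $$ (\<pi> i, j)))"
    then have ij: "i < n" "j < n" by auto
    have "(P * ?B) $$ (i, j) = (\<Sum>k<n. (if k = \<pi> i then 1 else 0) * ?B $$ (k, j))"
      using ij dims by (simp add: P_def scalar_prod_def lessThan_atLeast0)
    also have "\<dots> = (\<Sum>k<n. if k = \<pi> i then ?B $$ (\<pi> i, j) else 0)"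
      by (intro sum.cong) auto
    finally show "(P * ?B) $$ (i, j) = Matrix.mat n n (\<lambda>(i, j). ?B $$ (\<pi> i, j)) $$ (i, j)"
      using ij pi_lt[of i] by simp
  qed (use dims in auto)
  have AP: "?A * P = P * ?B"
  proof (unfold PB, rule eq_matI)
    fix i j
    assume "i < dim_row (Matrix.mat n n (\<lambda>(i, j). ?B $$ (\<pi> i, j)))"
      "j < dim_col (Matrix.mat n n (\<lambda>(i, j). ?B $$ (\<pi> i, j)))"
    then have ij: "i < n" "j < n" by auto
    from pi ij(2) obtain l where l: "l < n" "j = \<pi> l" by (auto simp: bij_betw_def)
    have "(?A * P) $$ (i, j) = (\<Sum>k<n. ?A $$ (i, k) * (if j = \<pi> k then 1 else 0))"
      using ij dims by (simp add: P_def scalar_prod_def lessThan_atLeast0)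
    also have "\<dots> = (\<Sum>k<n. if k = l then ?A $$ (i, l) else 0)"
      using l pi_eq by (intro sum.cong) auto
    also have "\<dots> = ?A $$ (i, l)" using l by simp
    also have "\<dots> = ?B $$ (\<pi> i, \<pi> l)"
      using ij l pi_lt gpi pi_eq
      by (simp add: laplacian_mat_def degree_mat_def adjacency_mat_def flip: n_def)
    finally show "(?A * P) $$ (i, j) = Matrix.mat n n (\<lambda>(i, j). ?B $$ (\<pi> i, j)) $$ (i, j)"
      using ij l by simp
  qed (use dims in auto)
  have "?A = ?A * (P * Q)" using dims by (simp add: PQ)
  also have "\<dots> = P * ?B * Q" using dims by (simp add: AP flip: assoc_mult_mat)
  finally show ?thesis
    using dims PQ QP unfolding similar_mat_def similar_mat_wit_def
    by (intro exI[of _ P] exI[of _ Q]) (auto simp: Let_def)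
qed

lemma laplacian_spectrum_enum:
  assumes "finite (pverts G)" and f: "bij_betw f {..<card (pverts G)} (pverts G)"
  shows "laplacian_spectrum G = proots (char_poly (map_mat complex_of_real (laplacian_mat f G)))"
proof -
  let ?g = "from_nat_into (pverts G)"
  have "char_poly (laplacian_mat ?g G) = char_poly (laplacian_mat f G)"
    by (intro char_poly_similar laplacian_mat_reindex bij_betw_from_nat_into_finite assms)
  moreover have "laplacian_mat h G \<in> carrier_mat (card (pverts G)) (card (pverts G))" for h
    by (auto simp: laplacian_mat_def degree_mat_def adjacency_mat_def)
  ultimately show ?thesis
    unfolding laplacian_spectrum_def by (metis of_real_hom.char_poly_hom)
qed

definition relabel :: "('a \<Rightarrow> 'b) \<Rightarrow> 'a pair_pre_digraph \<Rightarrow> 'b pair_pre_digraph" where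
  "relabel h G = \<lparr> pverts = h ` pverts G, parcs = map_prod h h ` parcs G \<rparr>"

lemma digraph_iso_relabel:
  assumes "pair_graph G" "inj_on h (pverts G)"
  shows "digraph_iso (with_proj G) (with_proj (relabel h G))"
proof -
  interpret pair_graph G by fact
  let ?f = "\<lparr> iso_verts = h, iso_arcs = map_prod h h, iso_head = snd, iso_tail = fst \<rparr>"
  have "inj_on (map_prod h h) (parcs G)"
    by (rule inj_on_subset[OF map_prod_inj_on[OF assms(2) assms(2)]])
      (auto dest: in_arcsD1 in_arcsD2)
  then have "digraph_isomorphism ?f"
    using assms(2) wf_digraph by (auto simp: digraph_isomorphism_def)
  moreover have "with_proj (relabel h G) = app_iso ?f (with_proj G)"
    by (simp add: app_iso_def relabel_def with_proj_def)
  ultimately show ?thesis unfolding digraph_iso_def by blast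
qed

lemma pair_graph_relabel:
  assumes "pair_graph G" "inj_on h (pverts G)"
  shows "pair_graph (relabel h G)"
proof -
  interpret pair_graph G by fact
  have sym: "(v, u) \<in> parcs G" if "(u, v) \<in> parcs G" for u v
    using that pair_sym_arcs by (auto simp: symmetric_def sym_def)
  show ?thesis
  proof unfold_locales
    fix e assume "e \<in> parcs (relabel h G)"
    then obtain u v where uv: "(u, v) \<in> parcs G" "e = (h u, h v)" by (auto simp: relabel_def)
    then have "u \<in> pverts G" "v \<in> pverts G" "u \<noteq> v"
      by (auto dest: in_arcsD1 in_arcsD2 no_loops')
    then show "fst e \<in> pverts (relabel h G)" "snd e \<in> pverts (relabel h G)" "fst e \<noteq> snd e"
      using uv(2) assms(2) by (auto simp: relabel_def dest: inj_onD)
  next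
    show "finite (pverts (relabel h G))" "finite (parcs (relabel h G))"
      using pair_finite_verts pair_finite_arcs by (auto simp: relabel_def)
    have "(y, x) \<in> parcs (relabel h G)" if "(x, y) \<in> parcs (relabel h G)" for x y
      using that by (auto simp: relabel_def dest: sym)
    then show "symmetric (with_proj (relabel h G))"
      by (simp add: symmetric_def sym_def)
  qed
qed

lemma L_cospectral_relabel:
  assumes "pair_graph G" "inj_on h (pverts G)"
  shows "L_cospectral (relabel h G) G"
proof -
  interpret pair_graph G by fact
  let ?f = "from_nat_into (pverts G)" and ?n = "card (pverts G)"
  have n: "card (pverts (relabel h G)) = ?n"
    using assms(2) by (simp add: relabel_def card_image)
  have f: "bij_betw ?f {..<?n} (pverts G)"
    by (intro bij_betw_from_nat_into_finite pair_finite_verts)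
  have hf: "bij_betw (h \<circ> ?f) {..<card (pverts (relabel h G))} (pverts (relabel h G))"
    unfolding n
    by (rule bij_betw_trans[OF f]) (use assms(2) in \<open>auto simp: bij_betw_def relabel_def\<close>)
  have arc: "(h u, h v) \<in> parcs (relabel h G) \<longleftrightarrow> (u, v) \<in> parcs G"
    if "u \<in> pverts G" "v \<in> pverts G" for u v
    using assms(2) that
    by (auto simp: relabel_def dest!: inj_onD[OF assms(2)] dest: in_arcsD1 in_arcsD2)
  have deg: "out_degree (with_proj (relabel h G)) (h u) = out_degree (with_proj G) u"
    if u: "u \<in> pverts G" for u
  proof -
    have "out_arcs (with_proj (relabel h G)) (h u) = map_prod h h ` out_arcs (with_proj G) u"
    proof (intro equalityI subsetI)
      fix e assume "e \<in> out_arcs (with_proj (relabel h G)) (h u)"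
      then obtain x y where xy: "(x, y) \<in> parcs G" "e = (h x, h y)" "h x = h u"
        by (auto simp: out_arcs_def relabel_def)
      then have "x = u" using u assms(2) in_arcsD1 by (auto dest: inj_onD)
      then have "(x, y) \<in> out_arcs (with_proj G) u" using xy(1) by (simp add: out_arcs_def)
      then show "e \<in> map_prod h h ` out_arcs (with_proj G) u"
        using xy(2) by (metis imageI map_prod_simp)
    qed (auto simp: out_arcs_def relabel_def)
    moreover have "inj_on (map_prod h h) (out_arcs (with_proj G) u)"
      by (rule inj_on_subset[OF map_prod_inj_on[OF assms(2) assms(2)]])
        (auto simp: out_arcs_def dest: in_arcsD1 in_arcsD2)
    ultimately show ?thesis by (simp add: out_degree_def card_image)
  qed
  have mem: "?f i \<in> pverts G" if "i < ?n" for i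
    using f that by (auto simp: bij_betw_def)
  have "laplacian_mat (h \<circ> ?f) (relabel h G) = laplacian_mat ?f G"
    by (rule eq_matI)
      (auto simp: laplacian_mat_def degree_mat_def adjacency_mat_def n deg mem arc)
  then show ?thesis
    unfolding L_cospectral_def
    using laplacian_spectrum_enum[OF _ hf] pair_finite_verts laplacian_spectrum_def[of G]
    by (simp add: relabel_def)
qed

lemma L_DS_any_type:
  fixes G :: "'a pair_pre_digraph" and H :: "'b pair_pre_digraph"
  assumes "L_DS G" "pair_graph H" "L_cospectral H G"
  shows "digraph_iso (with_proj H) (with_proj G)"
proof -
  interpret H: pair_graph H by fact
  obtain h :: "'b \<Rightarrow> nat" where h: "inj_on h (pverts H)"
    using finite_imp_inj_to_nat_seg[OF H.pair_finite_verts] by blast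
  have "L_cospectral (relabel h H) G"
    using L_cospectral_relabel[OF assms(2) h] assms(3) by (simp add: L_cospectral_def)
  then have 1: "digraph_iso (with_proj (relabel h H)) (with_proj G)"
    using assms(1) pair_graph_relabel[OF assms(2) h] by (auto simp: L_DS_def)
  from digraph_iso_relabel[OF assms(2) h] 1 show ?thesis
    by (rule digraph_iso_trans)
qed

end

theory Submission
  imports Defs "Jordan_Normal_Form.Schur_Decomposition"
begin

text \<open>
  For a graph on \<open>N\<close> vertices let \<open>K = N I - J - L\<close> be the Laplacian of the complement. The spectra of
  \<open>L\<close> and \<open>K\<close> determine each other, and joining with \<open>K\<^sub>m\<close> only adds \<open>m\<close> zeros to the spectrum of \<open>K\<close>.
  So it suffices that a graph \<open>H\<close> cospectral with \<open>T \<times> K\<^sub>m\<close> has \<open>m\<close> universal vertices: deleting them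
  leaves a graph cospectral with \<open>T\<close>.

  Let \<open>T\<close> have \<open>n \<ge> 3\<close> vertices. A leaf of \<open>T\<close> gives a test vector showing that \<open>K\<close> has an eigenvalue
  greater than \<open>n - 1\<close>, or greater than \<open>n - 2\<close> if \<open>T\<close> is a star. An eigenvalue of \<open>K\<close> is at most the
  size of some component of the complement, so the complement of \<open>H\<close> has a component with at least
  \<open>n\<close> (or \<open>n - 1\<close>) vertices. Since \<open>0\<close> has multiplicity at least \<open>m + 1\<close> (or \<open>m + 2\<close>), the remaining
  \<open>m\<close> (or \<open>m + 1\<close>) vertices must all be isolated in the complement.
\<close>

subsection \<open>Real symmetric matrices\<close>

text \<open>A complex eigenvalue \<open>z\<close> with eigenvector \<open>v\<close> exists because
  the complex polynomial splits. The form \<open>q\<close>, which is v* A v, is fixed by conjugation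
  and equals \<open>z\<close> times the squared norm of \<open>v\<close>, so \<open>z\<close> is
  real.\<close>

lemma real_symmetric_eigenvalue_exists:
  fixes A :: "real mat"
  assumes A: "A \<in> carrier_mat n n" and sym: "transpose_mat A = A" and n: "n > 0"
  shows "\<exists>e. eigenvalue A e"
proof -
  let ?c = "complex_of_real"
  let ?B = "map_mat ?c A"
  have B: "?B \<in> carrier_mat n n" using A by simp
  from char_poly_factorized[OF B] obtain as where
    as: "char_poly ?B = (\<Prod>a\<leftarrow>as. [:- a, 1:])" "length as = n" by blast
  obtain z zs where "as = z # zs" using as(2) n by (cases as) auto
  then have rt: "poly (char_poly ?B) z = 0" using as(1) by simp
  then have "eigenvalue ?B z" using eigenvalue_root_char_poly[OF B] by blast
  then obtain v where v: "v \<in> carrier_vec n" "v \<noteq> 0\<^sub>v n" "?B *\<^sub>v v = z \<cdot>\<^sub>v v"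
    using B unfolding eigenvalue_def eigenvector_def by auto
  have Bv: "(\<Sum>j<n. ?c (A $$ (i, j)) * v $ j) = z * v $ i" if "i < n" for i
  proof -
    have "(?B *\<^sub>v v) $ i = (\<Sum>j<n. ?c (A $$ (i, j)) * v $ j)"
      using A v(1) that by (simp add: scalar_prod_def lessThan_atLeast0)
    then show ?thesis using v that by simp
  qed
  have symA: "A $$ (i, j) = A $$ (j, i)" if "i < n" "j < n" for i j
    using sym A that by (metis carrier_matD index_transpose_mat(1))
  define q where "q = (\<Sum>i<n. \<Sum>j<n. cnj (v $ i) * ?c (A $$ (i, j)) * v $ j)"
  define s where "s = (\<Sum>i<n. (cmod (v $ i))\<^sup>2)"
  have "cnj q = (\<Sum>i<n. \<Sum>j<n. v $ i * ?c (A $$ (i, j)) * cnj (v $ j))"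
    by (simp add: q_def)
  also have "\<dots> = (\<Sum>j<n. \<Sum>i<n. v $ i * ?c (A $$ (i, j)) * cnj (v $ j))"
    by (rule sum.swap)
  also have "\<dots> = q" unfolding q_def by (intro sum.cong refl) (simp add: symA)
  finally have q: "cnj q = q" .
  have "q = (\<Sum>i<n. cnj (v $ i) * (\<Sum>j<n. ?c (A $$ (i, j)) * v $ j))"
    by (simp add: q_def sum_distrib_left mult.assoc)
  also have "\<dots> = (\<Sum>i<n. cnj (v $ i) * (z * v $ i))"
    by (intro sum.cong refl) (simp add: Bv)
  also have "\<dots> = (\<Sum>i<n. z * ?c ((cmod (v $ i))\<^sup>2))"
    by (intro sum.cong refl) (simp add: complex_norm_square mult_ac del: of_real_power)
  also have "\<dots> = z * ?c s" by (simp add: s_def sum_distrib_left)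
  finally have qs: "q = z * ?c s" .
  obtain i where i: "i < n" "v $ i \<noteq> 0" using v by (metis carrier_vecD eq_vecI index_zero_vec)
  have "s > 0" unfolding s_def
    by (rule sum_pos2[of _ i]) (use i in auto)
  with q qs have "cnj z = z" by simp
  then have z: "z = ?c (Re z)" by (metis Reals_cnj_iff complex_is_Real_iff of_real_Re)
  have "poly (map_poly ?c (char_poly A)) (?c (Re z)) = 0"
    using rt z by (metis of_real_hom.char_poly_hom[OF A])
  then have "poly (char_poly A) (Re z) = 0" by simp
  then show ?thesis using eigenvalue_root_char_poly[OF A] by blast
qed

text \<open>Gram-Schmidt on a basis that starts with \<open>v\<close> leaves \<open>v\<close>
  unchanged; dividing every vector by its norm makes the columns orthonormal, hence the factor
  \<open>c\<close>.\<close>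

lemma orthogonal_mat_first_col:
  fixes v :: "real vec"
  assumes v: "v \<in> carrier_vec n" "v \<noteq> 0\<^sub>v n"
  shows "\<exists>W c. W \<in> carrier_mat n n \<and> transpose_mat W * W = 1\<^sub>m n \<and> col W 0 = c \<cdot>\<^sub>v v"
proof -
  interpret cof_vec_space n "TYPE(real)" .
  have n: "n > 0" using v by (cases n) auto
  define b where "b = basis_completion v"
  define ws where "ws = gram_schmidt n b"
  from basis_completion[OF v, folded b_def]
  have dist_b: "distinct b" and indep: "\<not> lin_dep (set b)" and b: "set b \<subseteq> carrier_vec n"
    and hdb: "hd b = v" and len_b: "length b = n" by auto
  from hdb len_b n obtain vs where bv: "b = v # vs" by (cases b) auto
  from gram_schmidt_result[OF b dist_b indep refl, folded ws_def]
  have ws: "set ws \<subseteq> carrier_vec n" "corthogonal ws" "length ws = n" by (auto simp: len_b)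
  from gram_schmidt_hd[OF v(1), of vs, folded bv] have hdws: "ws ! 0 = v"
    using ws n by (metis hd_conv_nth length_greater_0_conv ws_def)
  have wsc: "ws ! i \<in> carrier_vec n" if "i < n" for i using ws that by auto
  have orth: "ws ! i \<bullet> ws ! j = 0 \<longleftrightarrow> i \<noteq> j" if "i < n" "j < n" for i j
    using corthogonalD[OF ws(2)] that ws(3) by simp
  have pos: "ws ! i \<bullet> ws ! i > 0" if "i < n" for i
  proof -
    have "ws ! i \<bullet> ws ! i \<ge> 0" by (simp add: scalar_prod_def sum_nonneg)
    then show ?thesis using orth[OF that that] by linarith
  qed
  define s where "s i = sqrt (ws ! i \<bullet> ws ! i)" for i
  define W where "W = Matrix.mat n n (\<lambda>(i, j). (ws ! j) $ i / s j)"
  have W: "W \<in> carrier_mat n n" by (simp add: W_def)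
  have "transpose_mat W * W = 1\<^sub>m n"
  proof (rule eq_matI)
    fix i j assume "i < dim_row (1\<^sub>m n :: real mat)" "j < dim_col (1\<^sub>m n :: real mat)"
    then have ij: "i < n" "j < n" by auto
    have "(transpose_mat W * W) $$ (i, j) = (\<Sum>l<n. (ws ! i) $ l / s i * ((ws ! j) $ l / s j))"
      using ij by (simp add: W_def scalar_prod_def lessThan_atLeast0)
    also have "\<dots> = (\<Sum>l<n. (ws ! i) $ l * (ws ! j) $ l) / (s i * s j)"
      by (simp add: sum_divide_distrib)
    also have "(\<Sum>l<n. (ws ! i) $ l * (ws ! j) $ l) = ws ! i \<bullet> ws ! j"
      using wsc[OF ij(2)] by (simp add: scalar_prod_def lessThan_atLeast0)
    also have "\<dots> / (s i * s j) = (1\<^sub>m n) $$ (i, j)"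
      using ij orth[OF ij] pos[OF ij(1)] by (auto simp: s_def)
    finally show "(transpose_mat W * W) $$ (i, j) = (1\<^sub>m n) $$ (i, j)" .
  qed (use W in auto)
  moreover have "col W 0 = (1 / s 0) \<cdot>\<^sub>v v"
    using n v hdws by (intro eq_vecI) (auto simp: W_def)
  ultimately show ?thesis using W by blast
qed

text \<open>Deflation: an eigenvector becomes, up to scaling, the first column of an orthogonal
  \<open>W\<close>. Then W^T A W is symmetric with zeros beside its corner entry, and the induction
  hypothesis diagonalizes the remaining block.\<close>

theorem real_symmetric_diagonalization:
  fixes A :: "real mat"
  assumes "A \<in> carrier_mat n n" "transpose_mat A = A"
  shows "\<exists>U D. U \<in> carrier_mat n n \<and> D \<in> carrier_mat n n \<and> diagonal_mat D
    \<and> transpose_mat U * U = 1\<^sub>m n \<and> A * U = U * D"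
  using assms
proof (induction n arbitrary: A)
  case 0
  then show ?case by (intro exI[of _ "1\<^sub>m 0"] exI[of _ A]) (auto simp: diagonal_mat_def)
next
  case (Suc n)
  note A = Suc.prems(1) and sym = Suc.prems(2)
  obtain e v where v: "v \<in> carrier_vec (Suc n)" "v \<noteq> 0\<^sub>v (Suc n)" "A *\<^sub>v v = e \<cdot>\<^sub>v v"
    using real_symmetric_eigenvalue_exists[OF A sym] A
    unfolding eigenvalue_def eigenvector_def by auto
  obtain W c where W: "W \<in> carrier_mat (Suc n) (Suc n)" "transpose_mat W * W = 1\<^sub>m (Suc n)"
    "col W 0 = c \<cdot>\<^sub>v v"
    using orthogonal_mat_first_col[OF v(1,2)] by blast
  have WW: "W * transpose_mat W = 1\<^sub>m (Suc n)"
    using mat_mult_left_right_inverse[OF _ W(1,2)] W(1) by simp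
  define B where "B = transpose_mat W * A * W"
  have B: "B \<in> carrier_mat (Suc n) (Suc n)" using A W by (auto simp: B_def)
  have symB: "transpose_mat B = B"
    using A W(1) sym by (simp add: B_def transpose_mult[of _ "Suc n" "Suc n" _ "Suc n"]
      assoc_mult_mat[of _ "Suc n" "Suc n" _ "Suc n" _ "Suc n"])
  have AW: "A * W = W * B"
  proof -
    have "W * B = W * transpose_mat W * (A * W)"
      using A W(1) by (simp add: B_def assoc_mult_mat[of _ "Suc n" "Suc n" _ "Suc n" _ "Suc n"])
    then show ?thesis using A W(1) by (simp add: WW)
  qed
  have Bi0: "B $$ (i, 0) = 0" if i: "0 < i" "i < Suc n" for i
  proof -
    have "col (A * W) 0 = A *\<^sub>v col W 0" using A W(1) by (intro col_mult2) auto
    also have "\<dots> = e \<cdot>\<^sub>v col W 0"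
      using A v W(3) by (simp add: mult_mat_vec smult_smult_assoc mult.commute)
    finally have "col (A * W) 0 = e \<cdot>\<^sub>v col W 0" .
    then have "B $$ (i, 0) = row (transpose_mat W) i \<bullet> (e \<cdot>\<^sub>v col W 0)"
      using A W(1) i by (simp add: B_def assoc_mult_mat[of _ "Suc n" "Suc n" _ "Suc n" _ "Suc n"])
    also have "\<dots> = e * (transpose_mat W * W) $$ (i, 0)" using W(1) i by simp
    finally show ?thesis using i by (simp add: W(2))
  qed
  have B0i: "B $$ (0, i) = 0" if i: "0 < i" "i < Suc n" for i
    using symB Bi0[OF i] B i by (metis carrier_matD index_transpose_mat(1) zero_less_Suc)
  define B' where "B' = Matrix.mat n n (\<lambda>(i, j). B $$ (Suc i, Suc j))"
  have B': "B' \<in> carrier_mat n n" by (simp add: B'_def)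
  have symB': "transpose_mat B' = B'"
  proof (rule eq_matI)
    fix i j assume "i < dim_row B'" "j < dim_col B'"
    then show "transpose_mat B' $$ (i, j) = B' $$ (i, j)"
      using symB B by (auto simp: B'_def) (metis Suc_less_eq carrier_matD index_transpose_mat(1))
  qed (simp_all add: B'_def)
  define a where "a = B $$ (0, 0)"
  have Bblock: "B = four_block_mat (mat 1 1 (\<lambda>_. a)) (0\<^sub>m 1 n) (0\<^sub>m n 1) B'"
    using B by (intro eq_matI) (auto simp: B'_def a_def Bi0 B0i less_Suc_eq_0_disj)
  from Suc.IH[OF B' symB'] obtain V D' where
    V: "V \<in> carrier_mat n n" "D' \<in> carrier_mat n n" "diagonal_mat D'"
      "transpose_mat V * V = 1\<^sub>m n" "B' * V = V * D'" by blast
  define V1 where "V1 = four_block_mat (1\<^sub>m 1) (0\<^sub>m 1 n) (0\<^sub>m n 1) V"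
  define D where "D = four_block_mat (mat 1 1 (\<lambda>_. a)) (0\<^sub>m 1 n) (0\<^sub>m n 1) D'"
  have V1: "V1 \<in> carrier_mat (Suc n) (Suc n)" and D: "D \<in> carrier_mat (Suc n) (Suc n)"
    using V by (auto simp: V1_def D_def)
  have V1V1: "transpose_mat V1 * V1 = 1\<^sub>m (Suc n)"
  proof -
    have "transpose_mat V1 = four_block_mat (1\<^sub>m 1) (0\<^sub>m 1 n) (0\<^sub>m n 1) (transpose_mat V)"
      unfolding V1_def using V(1)
      by (subst transpose_four_block_mat) auto
    then have "transpose_mat V1 * V1
        = four_block_mat (1\<^sub>m 1) (0\<^sub>m 1 n) (0\<^sub>m n 1) (transpose_mat V * V)"
      unfolding V1_def using V(1)
      by (simp add: mult_four_block_mat[of _ 1 1 _ n _ n _ _ 1 _ n])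
    then show ?thesis by (simp add: V(4))
  qed
  have BV: "B * V1 = V1 * D"
    unfolding Bblock V1_def D_def using V B'
    by (simp add: mult_four_block_mat[of _ 1 1 _ n _ n _ _ 1 _ n])
  let ?U = "W * V1"
  have "transpose_mat ?U * ?U = transpose_mat V1 * (transpose_mat W * W) * V1"
    using W(1) V1 by (simp add: transpose_mult[of _ "Suc n" "Suc n" _ "Suc n"]
      assoc_mult_mat[of _ "Suc n" "Suc n" _ "Suc n" _ "Suc n"])
  also have "\<dots> = 1\<^sub>m (Suc n)" using V1 by (simp add: W(2) V1V1)
  finally have 1: "transpose_mat ?U * ?U = 1\<^sub>m (Suc n)" .
  have "A * ?U = (A * W) * V1" using A W(1) V1 by simp
  also have "\<dots> = W * (B * V1)" using W(1) B V1 by (simp add: AW)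
  also have "\<dots> = ?U * D" using W(1) D V1 by (simp add: BV)
  finally have 2: "A * ?U = ?U * D" .
  have "diagonal_mat D"
    using V(2,3) by (auto simp: D_def diagonal_mat_def)
  with 1 2 W(1) V1 D show ?case by (intro exI[of _ ?U] exI[of _ D]) auto
qed

text \<open>In the coordinates \<open>a\<close> of the eigenbasis given by \<open>U\<close>, the
  matrix scales entry \<open>i\<close> by \<open>d i\<close>, and the same \<open>d\<close> lists
  the roots of the characteristic polynomial with multiplicity.\<close>

lemma real_symmetric_spectral:
  fixes A :: "real mat"
  assumes A: "A \<in> carrier_mat n n" and sym: "transpose_mat A = A"
  obtains U d where "U \<in> carrier_mat n n" "transpose_mat U * U = 1\<^sub>m n" "U * transpose_mat U = 1\<^sub>m n"
    "\<And>a. a \<in> carrier_vec n \<Longrightarrow> A *\<^sub>v (U *\<^sub>v a) = U *\<^sub>v vec n (\<lambda>i. d i * a $ i)"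
    "char_poly A = (\<Prod>i<n. [:- d i, 1:])"
proof -
  from real_symmetric_diagonalization[OF A sym] obtain U D where
    U: "U \<in> carrier_mat n n" and D: "D \<in> carrier_mat n n" "diagonal_mat D"
    and UU: "transpose_mat U * U = 1\<^sub>m n" and AU: "A * U = U * D" by blast
  have UU': "U * transpose_mat U = 1\<^sub>m n"
    using mat_mult_left_right_inverse[OF _ U UU] U by simp
  have "A = A * (U * transpose_mat U)" using A by (simp add: UU')
  also have "\<dots> = U * D * transpose_mat U" using A U D(1) by (simp flip: assoc_mult_mat AU)
  finally have "similar_mat A D"
    using A U D UU UU' unfolding similar_mat_def similar_mat_wit_def
    by (intro exI[of _ U] exI[of _ "transpose_mat U"]) (auto simp: Let_def)
  then have "char_poly A = char_poly D" by (rule char_poly_similar)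
  also have "\<dots> = (\<Prod>a\<leftarrow>diag_mat D. [:- a, 1:])"
    by (rule char_poly_upper_triangular[OF D(1)]) (use D in \<open>auto simp: diagonal_mat_def upper_triangular_def\<close>)
  also have "\<dots> = (\<Prod>i<n. [:- D $$ (i, i), 1:])"
    using D(1) by (simp add: diag_mat_def prod.list_conv_set_nth lessThan_atLeast0)
  finally have cp: "char_poly A = (\<Prod>i<n. [:- D $$ (i, i), 1:])" .
  have AUv: "A *\<^sub>v (U *\<^sub>v a) = U *\<^sub>v vec n (\<lambda>i. D $$ (i, i) * a $ i)" if a: "a \<in> carrier_vec n" for a
  proof -
    have "D *\<^sub>v a = vec n (\<lambda>i. D $$ (i, i) * a $ i)"
    proof (rule eq_vecI)
      fix i assume "i < dim_vec (vec n (\<lambda>i. D $$ (i, i) * a $ i))"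
      then have i: "i < n" by simp
      have "(D *\<^sub>v a) $ i = (\<Sum>j<n. D $$ (i, j) * a $ j)"
        using i D(1) a by (simp add: scalar_prod_def lessThan_atLeast0)
      also have "\<dots> = (\<Sum>j<n. if j = i then D $$ (i, i) * a $ i else 0)"
        using i D by (intro sum.cong) (auto simp: diagonal_mat_def)
      finally show "(D *\<^sub>v a) $ i = vec n (\<lambda>i. D $$ (i, i) * a $ i) $ i" using i by simp
    qed (use D in auto)
    moreover have "A *\<^sub>v (U *\<^sub>v a) = U *\<^sub>v (D *\<^sub>v a)"
      using assoc_mult_mat_vec[OF A U a] assoc_mult_mat_vec[OF U D(1) a] AU by simp
    ultimately show ?thesis by simp
  qed
  show ?thesis by (rule that[OF U UU UU' AUv cp])
qed

text \<open>Used to read the multiplicity of the eigenvalue 0 as the number of free coordinates in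
  the eigenbasis.\<close>

lemma order_prod_linear_factors:
  fixes d :: "'i \<Rightarrow> 'a :: idom"
  assumes "finite S"
  shows "Polynomial.order a (\<Prod>i\<in>S. [:- d i, 1:]) = card {i \<in> S. d i = a}"
  using assms
proof (induction S)
  case (insert x S)
  have "(\<Prod>i\<in>S. [:- d i, 1:]) \<noteq> 0" using insert.hyps by (simp add: prod_zero_iff)
  moreover have "Polynomial.order a [:- d x, 1:] = (if d x = a then 1 else 0)"
    using order_power_n_n[of a 1] by (auto simp: order_0I)
  moreover have "{i \<in> insert x S. d i = a} = (if d x = a then insert x {i \<in> S. d i = a} else {i \<in> S. d i = a})"
    by auto
  ultimately show ?case using insert by (simp add: order_mult del: mult_pCons_left)
qed (simp add: order_0I)

text \<open>
  The eigenspace of a symmetric matrix has the algebraic multiplicity as its dimension, so it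
  contains a nonzero solution of any smaller number of linear equations.
\<close>

lemma symmetric_kernel_vanishing_on:
  fixes A :: "real mat"
  assumes A: "A \<in> carrier_mat n n" and sym: "transpose_mat A = A"
    and ord: "k < Polynomial.order 0 (char_poly A)" and E: "E \<subseteq> {..<n}" "card E \<le> k"
  obtains w where "w \<in> carrier_vec n" "w \<noteq> 0\<^sub>v n" "A *\<^sub>v w = 0\<^sub>v n" "\<And>i. i \<in> E \<Longrightarrow> w $ i = 0"
proof -
  obtain U d where U: "U \<in> carrier_mat n n" and UU: "transpose_mat U * U = 1\<^sub>m n"
    and UU': "U * transpose_mat U = 1\<^sub>m n"
    and AU: "\<And>a. a \<in> carrier_vec n \<Longrightarrow> A *\<^sub>v (U *\<^sub>v a) = U *\<^sub>v vec n (\<lambda>i. d i * a $ i)"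
    and cp: "char_poly A = (\<Prod>i<n. [:- d i, 1:])"
    by (rule real_symmetric_spectral[OF A sym]) (rule that)
  define I where "I = {i \<in> {..<n}. d i = 0}"
  have cI: "k < card I" using ord by (simp add: cp order_prod_linear_factors I_def)
  have finE: "finite E" using E(1) finite_subset by blast
  have "card E \<le> card I" using cI E(2) by simp
  then obtain g where g: "g ` E \<subseteq> I" "inj_on g E"
    using card_le_inj[OF finE, of I] by (auto simp: I_def)
  have "card (g ` E) < card I" using E(2) cI card_image_le[OF finE, of g] by linarith
  then obtain i0 where i0: "i0 \<in> I" "i0 \<notin> g ` E"
    by (metis card_mono finE finite_imageI linorder_not_less subsetI)
  define h where "h i = the_inv_into E g i" for i
  have hg: "h (g t) = t" if "t \<in> E" for t using g(2) that by (simp add: h_def the_inv_into_f_f)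
  \<comment> \<open>A square system for the coordinates \<open>a\<close>: row \<open>i\<close>
    outside \<open>I\<close> says that \<open>a $ i\<close> is 0, row \<open>g t\<close> says that
    entry \<open>t\<close> of U a is 0. Row \<open>i0\<close> is zero, so \<open>M\<close> is
    singular.\<close>
  define M where "M = Matrix.mat n n (\<lambda>(i, j). if i \<notin> I then (if i = j then 1 else 0)
    else if i \<in> g ` E then U $$ (h i, j) else 0)"
  have M: "M \<in> carrier_mat n n" by (simp add: M_def)
  have i0n: "i0 < n" using i0 by (simp add: I_def)
  have "transpose_mat M *\<^sub>v unit_vec n i0 = 0\<^sub>v n"
    using i0 i0n by (intro eq_vecI) (auto simp: M_def)
  then have "det (transpose_mat M) = 0"
    using det_0_iff_vec_prod_zero[of "transpose_mat M" n] M i0n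
    by (metis transpose_carrier_mat unit_vec_carrier unit_vec_nonzero)
  then have "det M = 0" using det_transpose[OF M] by simp
  then obtain a where a: "a \<in> carrier_vec n" "a \<noteq> 0\<^sub>v n" "M *\<^sub>v a = 0\<^sub>v n"
    using det_0_iff_vec_prod_zero[OF M] by blast
  have Ma: "row M i \<bullet> a = 0" if "i < n" for i
    using a M that by (metis carrier_matD(1) index_mult_mat_vec index_zero_vec(1))
  have aI: "a $ i = 0" if i: "i < n" "i \<notin> I" for i
  proof -
    have "row M i = unit_vec n i" using i by (intro eq_vecI) (auto simp: M_def)
    then show ?thesis using Ma[OF i(1)] a(1) i by simp
  qed
  define w where "w = U *\<^sub>v a"
  have w: "w \<in> carrier_vec n" using U a by (simp add: w_def)
  have "transpose_mat U *\<^sub>v w = a"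
    using U a UU by (simp add: w_def flip: assoc_mult_mat_vec)
  then have "w \<noteq> 0\<^sub>v n" using a U by auto
  moreover have "A *\<^sub>v w = 0\<^sub>v n"
  proof -
    have "vec n (\<lambda>i. d i * a $ i) = 0\<^sub>v n"
      using aI by (intro eq_vecI) (auto simp: I_def)
    moreover have "U *\<^sub>v 0\<^sub>v n = 0\<^sub>v n" using U by (intro eq_vecI) auto
    ultimately show ?thesis using AU[OF a(1)] by (simp add: w_def)
  qed
  moreover have "w $ t = 0" if t: "t \<in> E" for t
  proof -
    have gt: "g t < n" "g t \<in> I" using g t by (auto simp: I_def)
    have tn: "t < n" using t E by auto
    have "row M (g t) = row U t"
      using gt t tn U hg[OF t] by (intro eq_vecI) (auto simp: M_def)
    then show ?thesis using Ma[OF gt(1)] U tn by (simp add: w_def)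
  qed
  ultimately show ?thesis by (intro that[OF w])
qed

text \<open>Rayleigh quotient: in eigenbasis coordinates x . A x is the sum of the squared
  coordinates weighted by the eigenvalues, so it cannot exceed t (x . x) unless some eigenvalue
  exceeds \<open>t\<close>.\<close>

lemma symmetric_eigenvalue_gt:
  fixes A :: "real mat"
  assumes A: "A \<in> carrier_mat n n" and sym: "transpose_mat A = A"
    and x: "x \<in> carrier_vec n" and gt: "x \<bullet> (A *\<^sub>v x) > t * (x \<bullet> x)"
  obtains e where "e > t" "poly (char_poly A) e = 0"
proof -
  obtain U d where U: "U \<in> carrier_mat n n" and UU: "transpose_mat U * U = 1\<^sub>m n"
    and UU': "U * transpose_mat U = 1\<^sub>m n"
    and AU: "\<And>a. a \<in> carrier_vec n \<Longrightarrow> A *\<^sub>v (U *\<^sub>v a) = U *\<^sub>v vec n (\<lambda>i. d i * a $ i)"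
    and cp: "char_poly A = (\<Prod>i<n. [:- d i, 1:])"
    by (rule real_symmetric_spectral[OF A sym]) (rule that)
  define a where "a = transpose_mat U *\<^sub>v x"
  have a: "a \<in> carrier_vec n" using U x by (simp add: a_def)
  have xa: "x = U *\<^sub>v a" using U x UU' by (simp add: a_def flip: assoc_mult_mat_vec)
  have iso: "x \<bullet> (U *\<^sub>v b) = a \<bullet> b" if b: "b \<in> carrier_vec n" for b
    using transpose_vec_mult_scalar[OF U b x] by (simp add: a_def)
  have "x \<bullet> (A *\<^sub>v x) = (\<Sum>i<n. d i * (a $ i)\<^sup>2)"
    by (subst (2) xa, subst AU[OF a], subst iso)
      (simp_all add: scalar_prod_def lessThan_atLeast0 power2_eq_square mult_ac)
  moreover have "x \<bullet> x = (\<Sum>i<n. (a $ i)\<^sup>2)"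
    using a by (subst (2) xa, subst iso)
      (simp_all add: scalar_prod_def lessThan_atLeast0 power2_eq_square)
  ultimately have lt: "(\<Sum>i<n. t * (a $ i)\<^sup>2) < (\<Sum>i<n. d i * (a $ i)\<^sup>2)"
    using gt by (simp add: sum_distrib_left)
  have "(\<Sum>i<n. d i * (a $ i)\<^sup>2) \<le> (\<Sum>i<n. t * (a $ i)\<^sup>2)" if "\<And>i. i < n \<Longrightarrow> d i \<le> t"
    using that by (intro sum_mono mult_right_mono) auto
  with lt obtain i where i: "i < n" "d i > t" by (meson linorder_not_less)
  moreover have "poly (char_poly A) (d i) = 0"
    using i(1) by (auto simp: cp poly_prod prod_zero_iff)
  ultimately show ?thesis using i that by blast
qed

subsection \<open>The Laplacian of the complement\<close>

text \<open>The neighbourhood of \<open>i\<close> in the complement of the graph with adjacency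
  relation \<open>R\<close>, so that \<open>co_laplacian\<close> is the matrix K.\<close>

definition non_nbrs :: "nat \<Rightarrow> (nat \<Rightarrow> nat \<Rightarrow> bool) \<Rightarrow> nat \<Rightarrow> nat set" where
  "non_nbrs n R i = {l. l < n \<and> l \<noteq> i \<and> \<not> R i l}"

definition co_laplacian :: "nat \<Rightarrow> (nat \<Rightarrow> nat \<Rightarrow> bool) \<Rightarrow> real mat" where
  "co_laplacian n R = Matrix.mat n n
     (\<lambda>(i, j). if i = j then real (card (non_nbrs n R i)) else if R i j then 0 else - 1)"

lemma finite_non_nbrs [simp]: "finite (non_nbrs n R i)"
  by (simp add: non_nbrs_def)

lemma co_laplacian_carrier [simp]: "co_laplacian n R \<in> carrier_mat n n"
  by (simp add: co_laplacian_def)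

lemma transpose_co_laplacian:
  assumes "\<And>i j. i < n \<Longrightarrow> j < n \<Longrightarrow> R i j = R j i"
  shows "transpose_mat (co_laplacian n R) = co_laplacian n R"
  using assms by (intro eq_matI) (auto simp: co_laplacian_def)

lemma co_laplacian_mult_vec:
  assumes w: "w \<in> carrier_vec n" and i: "i < n"
  shows "(co_laplacian n R *\<^sub>v w) $ i = (\<Sum>l\<in>non_nbrs n R i. w $ i - w $ l)"
proof -
  have "(co_laplacian n R *\<^sub>v w) $ i = (\<Sum>l<n. co_laplacian n R $$ (i, l) * w $ l)"
    using w i by (simp add: scalar_prod_def lessThan_atLeast0 co_laplacian_def)
  also have "\<dots> = (\<Sum>l<n. (if l = i then real (card (non_nbrs n R i)) * w $ i else 0)
      - (if l \<in> non_nbrs n R i then w $ l else 0))"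
    using i by (intro sum.cong) (auto simp: co_laplacian_def non_nbrs_def)
  also have "\<dots> = real (card (non_nbrs n R i)) * w $ i - (\<Sum>l\<in>{..<n} \<inter> non_nbrs n R i. w $ l)"
    using i by (simp add: sum_subtractf sum.inter_restrict)
  also have "{..<n} \<inter> non_nbrs n R i = non_nbrs n R i" by (auto simp: non_nbrs_def)
  finally show ?thesis by (simp add: sum_subtractf)
qed

text \<open>The quadratic form of K vanishes at \<open>w\<close>. Twice this form is the sum of the
  squared differences of entries of \<open>w\<close> over ordered pairs adjacent in the complement,
  so every such difference is zero.\<close>

lemma co_laplacian_kernel_eq:
  assumes sym: "\<And>i j. i < n \<Longrightarrow> j < n \<Longrightarrow> R i j = R j i"
    and w: "w \<in> carrier_vec n" "co_laplacian n R *\<^sub>v w = 0\<^sub>v n"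
    and ij: "i < n" "j \<in> non_nbrs n R i"
  shows "w $ i = w $ j"
proof -
  define b where "b i l = (if l \<in> non_nbrs n R i then 1 else 0 :: real)" for i l
  have b_sym: "b i l = b l i" if "i < n" "l < n" for i l
    using that sym by (auto simp: b_def non_nbrs_def)
  have zero: "(\<Sum>l<n. b i l * (w $ i - w $ l)) = 0" if "i < n" for i
  proof -
    have "(\<Sum>l<n. b i l * (w $ i - w $ l)) = (\<Sum>l\<in>{..<n} \<inter> non_nbrs n R i. w $ i - w $ l)"
      by (simp add: sum.inter_restrict b_def if_distrib[of "\<lambda>x. x * _"] cong: if_cong)
    also have "{..<n} \<inter> non_nbrs n R i = non_nbrs n R i" by (auto simp: non_nbrs_def)
    finally show ?thesis using co_laplacian_mult_vec[OF w(1) that, of R] w that by simp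
  qed
  have 1: "(\<Sum>i<n. \<Sum>l<n. w $ i * (b i l * (w $ i - w $ l))) = 0"
    by (simp add: zero flip: sum_distrib_left)
  \<comment> \<open>Exchanging the two indices, by symmetry of \<open>b\<close>, gives a second copy
    of the form; adding both copies produces the squares.\<close>
  then have "(\<Sum>l<n. \<Sum>i<n. w $ i * (b i l * (w $ i - w $ l))) = 0"
    by (subst sum.swap)
  then have 2: "(\<Sum>i<n. \<Sum>l<n. w $ l * (b i l * (w $ l - w $ i))) = 0"
    by (simp add: b_sym cong: sum.cong_simp)
  have "(\<Sum>i<n. \<Sum>l<n. b i l * (w $ i - w $ l)\<^sup>2)
    = (\<Sum>i<n. \<Sum>l<n. w $ i * (b i l * (w $ i - w $ l))) + (\<Sum>i<n. \<Sum>l<n. w $ l * (b i l * (w $ l - w $ i)))"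
    by (simp add: power2_eq_square algebra_simps flip: sum.distrib)
  then have "(\<Sum>i<n. \<Sum>l<n. b i l * (w $ i - w $ l)\<^sup>2) = 0" using 1 2 by simp
  then have "(\<Sum>l<n. b i l * (w $ i - w $ l)\<^sup>2) = 0"
    using ij(1) by (subst (asm) sum_nonneg_eq_0_iff) (auto simp: b_def intro!: sum_nonneg)
  moreover have "j < n" using ij by (auto simp: non_nbrs_def)
  ultimately have "b i j * (w $ i - w $ j)\<^sup>2 = 0"
    by (subst (asm) sum_nonneg_eq_0_iff) (auto simp: b_def)
  then show ?thesis using ij(2) by (simp add: b_def)
qed

text \<open>
  Adding the eigenvalue equations at a maximum and at a minimum of the eigenvector on \<open>C\<close> makes
  every vertex of \<open>C\<close> contribute at most the difference of the two values.
\<close>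

lemma co_laplacian_eigenvalue_le:
  assumes y: "y \<in> carrier_vec n" "co_laplacian n R *\<^sub>v y = e \<cdot>\<^sub>v y"
    and C: "C \<subseteq> {..<n}" "\<And>i. i \<in> C \<Longrightarrow> non_nbrs n R i \<subseteq> C"
    and c: "c \<in> C" "y $ c \<noteq> 0"
  shows "e \<le> real (card C)"
proof -
  have finC: "finite C" using C(1) finite_subset by blast
  have ev: "e * y $ i = (\<Sum>l\<in>non_nbrs n R i. y $ i - y $ l)" if "i \<in> C" for i
    using co_laplacian_mult_vec[OF y(1), of i R] y that C(1) by auto
  have "Max ((\<lambda>i. y $ i) ` C) \<in> (\<lambda>i. y $ i) ` C" using finC c by (intro Max_in) auto
  then obtain a where a: "a \<in> C" "y $ a = Max ((\<lambda>i. y $ i) ` C)" by auto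
  have "Min ((\<lambda>i. y $ i) ` C) \<in> (\<lambda>i. y $ i) ` C" using finC c by (intro Min_in) auto
  then obtain b where b: "b \<in> C" "y $ b = Min ((\<lambda>i. y $ i) ` C)" by auto
  have max: "y $ i \<le> y $ a" and min: "y $ b \<le> y $ i" if "i \<in> C" for i
    using that finC a b by simp_all
  show ?thesis
  proof (cases "y $ a = y $ b")
    case True
    \<comment> \<open>All differences vanish on \<open>C\<close>, so \<open>e\<close> times the
      nonzero entry at \<open>c\<close> is 0, and \<open>e\<close> is 0.\<close>
    then have "y $ i = y $ c" if "i \<in> C" for i using max min that c(1) by (metis order_antisym_conv)
    then have "e * y $ c = 0" using ev[OF c(1)] C(2)[OF c(1)] by (auto intro!: sum.neutral)
    then show ?thesis using c(2) by simp
  next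
    case False
    then have pos: "y $ a - y $ b > 0" using min[OF a(1)] by simp
    have "e * y $ a \<le> (\<Sum>l\<in>C. y $ a - y $ l)"
      unfolding ev[OF a(1)] using max C(2)[OF a(1)] by (intro sum_mono2 finC) auto
    moreover have "- (e * y $ b) = (\<Sum>l\<in>non_nbrs n R b. y $ l - y $ b)"
      unfolding ev[OF b(1)] by (simp flip: sum_negf)
    moreover have "\<dots> \<le> (\<Sum>l\<in>C. y $ l - y $ b)"
      using min C(2)[OF b(1)] by (intro sum_mono2 finC) auto
    moreover have "(\<Sum>l\<in>C. y $ a - y $ l) + (\<Sum>l\<in>C. y $ l - y $ b) = real (card C) * (y $ a - y $ b)"
      by (simp flip: sum.distrib)
    ultimately have "e * (y $ a - y $ b) \<le> real (card C) * (y $ a - y $ b)"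
      by (simp add: right_diff_distrib)
    then show ?thesis using pos by simp
  qed
qed

text \<open>
  A component of the complement has at least \<open>n - k\<close> vertices, so at most \<open>k\<close> vertices lie outside
  of it. The kernel vectors are constant on the components of the complement and form a space of
  dimension greater than \<open>k\<close>, so every vertex outside is a component of its own.
\<close>

lemma card_dominating_ge:
  assumes sym: "\<And>i j. i < n \<Longrightarrow> j < n \<Longrightarrow> R i j = R j i"
    and ord: "k < Polynomial.order 0 (char_poly (co_laplacian n R))"
    and ev: "n \<le> k + 1 \<or> (\<exists>e. e > real n - real k - 1 \<and> poly (char_poly (co_laplacian n R)) e = 0)"
  shows "k \<le> card {i. i < n \<and> non_nbrs n R i = {}}"
proof -
  let ?K = "co_laplacian n R"
  have "?K \<in> carrier_mat n n" by simp
  note mon = degree_monic_char_poly[OF this]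
  then have "char_poly ?K \<noteq> 0" by auto
  from order_degree[OF this, of 0] have kn: "k < n" using ord mon by simp
  define P where "P = {(i, j). i < n \<and> j \<in> non_nbrs n R i}"
  define comp where "comp c = P\<^sup>* `` {c}" for c
  have c_comp: "c \<in> comp c" for c by (simp add: comp_def)
  have comp_lt: "comp c \<subseteq> {..<n}" if "c < n" for c
  proof
    fix x assume "x \<in> comp c"
    then have "(c, x) \<in> P\<^sup>*" by (simp add: comp_def)
    then show "x \<in> {..<n}" using that by induction (auto simp: P_def non_nbrs_def)
  qed
  have comp_closed: "non_nbrs n R i \<subseteq> comp c" if "i \<in> comp c" "c < n" for i c
  proof
    fix j assume "j \<in> non_nbrs n R i"
    then have "(i, j) \<in> P" using comp_lt that by (auto simp: P_def)
    then show "j \<in> comp c" using that by (auto simp: comp_def)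
  qed
  \<comment> \<open>If \<open>n \<le> k + 1\<close>, any single vertex is enough. Otherwise the
    component of a nonzero entry of the eigenvector has at least \<open>e\<close> vertices, and as
    sizes are integers, e > n - k - 1 gives at least n - k.\<close>
  obtain c where c: "c < n" "n \<le> card (comp c) + k"
  proof (cases "n \<le> k + 1")
    case True
    have "card (comp 0) \<ge> 1"
      using c_comp[of 0] comp_lt[of 0] kn finite_subset[of "comp 0" "{..<n}"]
      by (metis Suc_leI card_gt_0_iff empty_iff finite_lessThan gr_zeroI not_less_zero One_nat_def)
    then show ?thesis using that[of 0] True kn by linarith
  next
    case False
    with ev obtain e where e: "e > real n - real k - 1" "poly (char_poly ?K) e = 0" by blast
    then have "eigenvalue ?K e" using eigenvalue_root_char_poly[of ?K n e] by simp
    then obtain y where y: "y \<in> carrier_vec n" "y \<noteq> 0\<^sub>v n" "?K *\<^sub>v y = e \<cdot>\<^sub>v y"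
      unfolding eigenvalue_def eigenvector_def by (auto simp: co_laplacian_def)
    then obtain c where c: "c < n" "y $ c \<noteq> 0" by (metis carrier_vecD eq_vecI index_zero_vec)
    have "e \<le> real (card (comp c))"
      using co_laplacian_eigenvalue_le[OF y(1,3) comp_lt[OF c(1)] _ c_comp c(2)]
        comp_closed[OF _ c(1)] by blast
    then show ?thesis using that[OF c(1)] e(1) by linarith
  qed
  define S where "S = {..<n} - comp c"
  have S: "finite S" "S \<subseteq> {..<n}" "c \<notin> S" using c_comp by (auto simp: S_def)
  have "card S = n - card (comp c)"
    using comp_lt[OF c(1)] by (simp add: S_def card_Diff_subset finite_subset[of _ "{..<n}"])
  then have card_S: "card S \<le> k" using c(2) by simp
  \<comment> \<open>Vanishing on at most \<open>k\<close> indices cannot force a kernel vector to be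
    zero, because the kernel has dimension greater than \<open>k\<close>.\<close>
  have no_kill: False
    if E: "E \<subseteq> {..<n}" "card E \<le> k"
      and kill: "\<And>w. w \<in> carrier_vec n \<Longrightarrow> ?K *\<^sub>v w = 0\<^sub>v n \<Longrightarrow> (\<And>i. i \<in> E \<Longrightarrow> w $ i = 0)
        \<Longrightarrow> (\<And>i. i < n \<Longrightarrow> w $ i = 0)" for E
  proof -
    obtain w where "w \<in> carrier_vec n" "w \<noteq> 0\<^sub>v n" "?K *\<^sub>v w = 0\<^sub>v n" "\<And>i. i \<in> E \<Longrightarrow> w $ i = 0"
      using symmetric_kernel_vanishing_on[OF co_laplacian_carrier transpose_co_laplacian[OF sym] ord E]
      by metis
    then show False using kill[of w] by (metis carrier_vecD eq_vecI index_zero_vec)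
  qed
  have const: "w $ i = w $ c" if w: "w \<in> carrier_vec n" "?K *\<^sub>v w = 0\<^sub>v n" and i: "i \<in> comp c" for w i
  proof -
    have "(c, i) \<in> P\<^sup>*" using i by (simp add: comp_def)
    then show ?thesis
      by induction (use co_laplacian_kernel_eq[OF sym w] in \<open>auto simp: P_def\<close>)
  qed
  \<comment> \<open>A kernel vector that is zero at \<open>c\<close> and on \<open>S\<close> is zero
    everywhere, since it is constant on \<open>comp c\<close>.\<close>
  have "\<not> card (insert c S) \<le> k"
  proof
    assume le: "card (insert c S) \<le> k"
    show False
    proof (rule no_kill[OF _ le])
      fix w i assume w: "w \<in> carrier_vec n" "?K *\<^sub>v w = 0\<^sub>v n" "\<And>i. i \<in> insert c S \<Longrightarrow> w $ i = 0"
        and "i < n"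
      then show "w $ i = 0" using const[OF w(1,2), of i] by (cases "i \<in> comp c") (auto simp: S_def)
    qed (use S c in auto)
  qed
  then have "k \<le> card S" using S by simp
  \<comment> \<open>If \<open>s\<close> had a neighbour \<open>t\<close> in the complement, the
    value at \<open>s\<close> would equal that at \<open>t\<close>. Then
    \<open>insert c (S - {s})\<close>, no larger than \<open>S\<close>, would already force a kernel
    vector to be zero.\<close>
  moreover have "non_nbrs n R s = {}" if s: "s \<in> S" for s
  proof (rule ccontr)
    assume "non_nbrs n R s \<noteq> {}"
    then obtain t where t: "t \<in> non_nbrs n R s" by auto
    then have tn: "t < n" "t \<noteq> s" by (auto simp: non_nbrs_def)
    show False
    proof (rule no_kill[of "insert c (S - {s})"])
      show "card (insert c (S - {s})) \<le> k" using S s card_S card_Suc_Diff1[of S s] by simp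
    next
      fix w i assume w: "w \<in> carrier_vec n" "?K *\<^sub>v w = 0\<^sub>v n"
        "\<And>i. i \<in> insert c (S - {s}) \<Longrightarrow> w $ i = 0" and i: "i < n"
      have *: "w $ j = 0" if "j < n" "j \<noteq> s" for j
        using const[OF w(1,2), of j] w(3) that by (cases "j \<in> comp c") (auto simp: S_def)
      have "w $ s = w $ t" using co_laplacian_kernel_eq[OF sym w(1,2) _ t] s S by auto
      with * tn i show "w $ i = 0" by metis
    qed (use S c in auto)
  qed
  then have "S \<subseteq> {i. i < n \<and> non_nbrs n R i = {}}" using S by auto
  then have "card S \<le> card {i. i < n \<and> non_nbrs n R i = {}}" by (intro card_mono) auto
  ultimately show ?thesis by simp
qed

subsection \<open>Characteristic polynomials of graphs\<close>

text \<open>Both complex polynomials are monic and split, so their roots determine them; injectivity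
  of the embedding carries the equality back to the reals.\<close>

lemma char_poly_eq_iff_proots_complex:
  fixes A B :: "real mat"
  assumes A: "A \<in> carrier_mat n n" and B: "B \<in> carrier_mat m m"
  shows "proots (char_poly (map_mat complex_of_real A)) = proots (char_poly (map_mat complex_of_real B))
    \<longleftrightarrow> char_poly A = char_poly B" (is "proots ?p = proots ?q \<longleftrightarrow> _")
proof
  have "map_mat complex_of_real A \<in> carrier_mat n n" "map_mat complex_of_real B \<in> carrier_mat m m"
    using A B by auto
  then have "lead_coeff ?p = 1" "lead_coeff ?q = 1"
    using degree_monic_char_poly by (metis, metis)
  moreover assume "proots ?p = proots ?q"
  ultimately have "?p = ?q"
    using complex_poly_decompose_multiset[of ?p] complex_poly_decompose_multiset[of ?q] by simp
  then have "map_poly complex_of_real (char_poly A) = map_poly complex_of_real (char_poly B)"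
    by (metis of_real_hom.char_poly_hom[OF A] of_real_hom.char_poly_hom[OF B])
  then have "coeff (map_poly complex_of_real (char_poly A)) i
      = coeff (map_poly complex_of_real (char_poly B)) i" for i
    by simp
  then show "char_poly A = char_poly B"
    by (intro poly_eqI) (simp add: coeff_map_poly)
next
  assume "char_poly A = char_poly B"
  then show "proots ?p = proots ?q"
    by (metis of_real_hom.char_poly_hom[OF A] of_real_hom.char_poly_hom[OF B])
qed

lemma char_poly_eval:
  fixes A :: "'a :: field mat"
  assumes "A \<in> carrier_mat n n"
  shows "poly (char_poly A) y = det (y \<cdot>\<^sub>m 1\<^sub>m n - A)"
proof -
  have "- char_matrix A y = y \<cdot>\<^sub>m 1\<^sub>m n - A"
    using assms by (intro eq_matI) (auto simp: char_matrix_def)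
  then show ?thesis using char_poly_matrix[OF assms] by simp
qed

text \<open>
  With the all-ones matrix \<open>J\<close> and \<open>L J = 0\<close> we have \<open>(y - L)(y - J) = y (y - L - J) = - y ((n - y) - K)\<close>.
\<close>

lemma char_poly_complement:
  fixes L K :: "real mat"
  assumes L: "L \<in> carrier_mat n n" and K: "K \<in> carrier_mat n n"
    and rows: "\<And>i. i < n \<Longrightarrow> (\<Sum>j<n. L $$ (i, j)) = 0"
    and LK: "\<And>i j. i < n \<Longrightarrow> j < n \<Longrightarrow> L $$ (i, j) + K $$ (i, j) + 1 = (if i = j then real n else 0)"
  shows "poly (char_poly L) y * poly (char_poly (Matrix.mat n n (\<lambda>_. 1 :: real))) y
    = (- y) ^ n * poly (char_poly K) (real n - y)"
proof -
  let ?J = "Matrix.mat n n (\<lambda>_. 1 :: real)"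
  have "(y \<cdot>\<^sub>m 1\<^sub>m n - L) * (y \<cdot>\<^sub>m 1\<^sub>m n - ?J) = (- y) \<cdot>\<^sub>m ((real n - y) \<cdot>\<^sub>m 1\<^sub>m n - K)"
  proof (rule eq_matI)
    fix i j
    assume "i < dim_row ((- y) \<cdot>\<^sub>m ((real n - y) \<cdot>\<^sub>m 1\<^sub>m n - K))"
      "j < dim_col ((- y) \<cdot>\<^sub>m ((real n - y) \<cdot>\<^sub>m 1\<^sub>m n - K))"
    then have ij: "i < n" "j < n" using K by auto
    have "((y \<cdot>\<^sub>m 1\<^sub>m n - L) * (y \<cdot>\<^sub>m 1\<^sub>m n - ?J)) $$ (i, j)
      = (\<Sum>l<n. ((if i = l then y else 0) - L $$ (i, l)) * ((if l = j then y else 0) - 1))"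
      using ij L by (simp add: scalar_prod_def lessThan_atLeast0 if_distrib[of "\<lambda>x. y * x"] cong: if_cong)
    also have "\<dots> = (\<Sum>l<n. (if l = i then (if i = j then y * y else 0) - y else 0)
        - (if l = j then y * L $$ (i, j) else 0) + L $$ (i, l))"
      by (intro sum.cong) (auto simp: algebra_simps)
    also have "\<dots> = (if i = j then y * y else 0) - y - y * L $$ (i, j)"
      using ij rows by (simp add: sum.distrib sum_subtractf)
    also have "\<dots> = - y * ((if i = j then real n - y else 0) - K $$ (i, j))"
    proof -
      have Kij: "K $$ (i, j) = (if i = j then real n else 0) - 1 - L $$ (i, j)"
        using LK[OF ij] by linarith
      show ?thesis unfolding Kij by (simp add: algebra_simps)
    qed
    also have "\<dots> = ((- y) \<cdot>\<^sub>m ((real n - y) \<cdot>\<^sub>m 1\<^sub>m n - K)) $$ (i, j)"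
      using ij K by simp
    finally show "((y \<cdot>\<^sub>m 1\<^sub>m n - L) * (y \<cdot>\<^sub>m 1\<^sub>m n - ?J)) $$ (i, j)
      = ((- y) \<cdot>\<^sub>m ((real n - y) \<cdot>\<^sub>m 1\<^sub>m n - K)) $$ (i, j)" .
  qed (use L K in auto)
  then have "det (y \<cdot>\<^sub>m 1\<^sub>m n - L) * det (y \<cdot>\<^sub>m 1\<^sub>m n - ?J) = (- y) ^ n * det ((real n - y) \<cdot>\<^sub>m 1\<^sub>m n - K)"
    using L K det_mult[of "y \<cdot>\<^sub>m 1\<^sub>m n - L" n "y \<cdot>\<^sub>m 1\<^sub>m n - ?J"] by (simp add: det_smult minus_carrier_mat)
  then show ?thesis
    by (simp add: char_poly_eval[OF L] char_poly_eval[OF K] char_poly_eval[of ?J n])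
qed

text \<open>In \<open>char_poly_complement\<close> the two other factors are nonzero polynomials
  that depend only on \<open>n\<close>, so they cancel.\<close>

lemma char_poly_complement_eq_iff:
  fixes L K L' K' :: "real mat"
  assumes L: "L \<in> carrier_mat n n" "K \<in> carrier_mat n n"
    and rows: "\<And>i. i < n \<Longrightarrow> (\<Sum>j<n. L $$ (i, j)) = 0"
    and LK: "\<And>i j. i < n \<Longrightarrow> j < n \<Longrightarrow> L $$ (i, j) + K $$ (i, j) + 1 = (if i = j then real n else 0)"
  assumes L': "L' \<in> carrier_mat n n" "K' \<in> carrier_mat n n"
    and rows': "\<And>i. i < n \<Longrightarrow> (\<Sum>j<n. L' $$ (i, j)) = 0"
    and LK': "\<And>i j. i < n \<Longrightarrow> j < n \<Longrightarrow> L' $$ (i, j) + K' $$ (i, j) + 1 = (if i = j then real n else 0)"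
  shows "char_poly L = char_poly L' \<longleftrightarrow> char_poly K = char_poly K'"
proof -
  let ?J = "Matrix.mat n n (\<lambda>_. 1 :: real)"
  note * = char_poly_complement[OF L rows LK] char_poly_complement[OF L' rows' LK']
  show ?thesis
  proof
    assume eq: "char_poly L = char_poly L'"
    \<comment> \<open>Substituting y = n - x makes \<open>char_poly K\<close> appear at
      \<open>x\<close> and turns (-y)^n into (x - n)^n.\<close>
    have "poly ([:- real n, 1:] ^ n * char_poly K) x = poly ([:- real n, 1:] ^ n * char_poly K') x" for x
      using *[of "real n - x"] by (auto simp: eq)
    then have "[:- real n, 1:] ^ n * char_poly K = [:- real n, 1:] ^ n * char_poly K'"
      using poly_eq_poly_eq_iff by blast
    then show "char_poly K = char_poly K'" by simp
  next
    assume eq: "char_poly K = char_poly K'"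
    have "char_poly ?J \<noteq> 0" using degree_monic_char_poly[of ?J n] by auto
    moreover have "poly (char_poly L * char_poly ?J) x = poly (char_poly L' * char_poly ?J) x" for x
      using * by (simp add: eq)
    then have "char_poly L * char_poly ?J = char_poly L' * char_poly ?J"
      using poly_eq_poly_eq_iff by blast
    ultimately show "char_poly L = char_poly L'" by simp
  qed
qed

lemma char_poly_block_diag_zero:
  fixes A :: "'a :: idom mat"
  assumes A: "A \<in> carrier_mat n n"
  shows "char_poly (four_block_mat A (0\<^sub>m n m) (0\<^sub>m m n) (0\<^sub>m m m)) = monom 1 m * char_poly A"
proof -
  have "char_poly_matrix (four_block_mat A (0\<^sub>m n m) (0\<^sub>m m n) (0\<^sub>m m m))
    = four_block_mat (char_poly_matrix A) (0\<^sub>m n m) (0\<^sub>m m n) (char_poly_matrix (0\<^sub>m m m))"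
    using A by (intro eq_matI) (auto simp: char_poly_matrix_def)
  then have "char_poly (four_block_mat A (0\<^sub>m n m) (0\<^sub>m m n) (0\<^sub>m m m)) = char_poly A * char_poly (0\<^sub>m m m)"
    using A unfolding char_poly_def by (simp add: det_four_block_mat_lower_left_zero[of _ n _ m])
  also have "char_poly (0\<^sub>m m m :: 'a mat) = monom 1 m"
  proof -
    have "diag_mat (0\<^sub>m m m :: 'a mat) = replicate m 0"
      by (intro nth_equalityI) (auto simp: diag_mat_def)
    then show ?thesis
      by (subst char_poly_upper_triangular[of _ m]) (auto simp: monom_altdef)
  qed
  finally show ?thesis by (simp add: mult.commute)
qed

text \<open>The characteristic polynomial of K, which replaces the Laplacian spectrum by
  \<open>L_cospectral_iff\<close>. By \<open>co_char_poly_enum\<close> every enumeration of the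
  vertices gives the same polynomial.\<close>

definition co_char_poly :: "'a pair_pre_digraph \<Rightarrow> real poly" where
  "co_char_poly G = char_poly (co_laplacian (card (pverts G))
     (\<lambda>i j. (from_nat_into (pverts G) i, from_nat_into (pverts G) j) \<in> parcs G))"

lemma laplacian_mat_carrier: "laplacian_mat f G \<in> carrier_mat (card (pverts G)) (card (pverts G))"
  by (auto simp: laplacian_mat_def degree_mat_def adjacency_mat_def)

context pair_graph
begin

lemma parcs_sym: "(u, v) \<in> parcs G \<longleftrightarrow> (v, u) \<in> parcs G"
  using pair_sym_arcs by (auto simp: symmetric_def sym_def)

lemma parcs_irrefl [simp]: "(u, u) \<notin> parcs G"
  using no_loops' by blast

lemma out_degree_enum:
  assumes f: "bij_betw f {..<card (pverts G)} (pverts G)"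
  shows "out_degree (with_proj G) u = card {j. j < card (pverts G) \<and> (u, f j) \<in> parcs G}"
proof -
  let ?N = "{j. j < card (pverts G) \<and> (u, f j) \<in> parcs G}"
  have "out_arcs (with_proj G) u = (\<lambda>j. (u, f j)) ` ?N"
    using f in_arcsD2 by (fastforce simp: out_arcs_def bij_betw_def)
  moreover have "inj_on (\<lambda>j. (u, f j)) ?N"
    using f by (auto simp: bij_betw_def inj_on_def)
  ultimately show ?thesis by (simp add: out_degree_def card_image)
qed

lemma laplacian_mat_row_sum:
  assumes f: "bij_betw f {..<card (pverts G)} (pverts G)" and i: "i < card (pverts G)"
  shows "(\<Sum>j<card (pverts G). laplacian_mat f G $$ (i, j)) = 0"
proof -
  let ?n = "card (pverts G)"
  have "(\<Sum>j<?n. laplacian_mat f G $$ (i, j))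
    = (\<Sum>j<?n. (if j = i then real (out_degree (with_proj G) (f i)) else 0)
        - of_bool ((f i, f j) \<in> parcs G))"
    using i by (intro sum.cong) (auto simp: laplacian_mat_def degree_mat_def adjacency_mat_def)
  also have "\<dots> = real (out_degree (with_proj G) (f i)) - real (card {j. j < ?n \<and> (f i, f j) \<in> parcs G})"
    using i by (simp add: sum_subtractf Int_def)
  finally show ?thesis by (simp add: out_degree_enum[OF f])
qed

text \<open>The identity L + K + J = n I. On the diagonal it counts the vertices as \<open>i\<close>
  itself, its neighbours and its non-neighbours.\<close>

lemma laplacian_mat_co_laplacian:
  assumes f: "bij_betw f {..<card (pverts G)} (pverts G)"
    and ij: "i < card (pverts G)" "j < card (pverts G)"
  shows "laplacian_mat f G $$ (i, j)
      + co_laplacian (card (pverts G)) (\<lambda>i j. (f i, f j) \<in> parcs G) $$ (i, j) + 1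
    = (if i = j then real (card (pverts G)) else 0)"
proof (cases "i = j")
  case True
  let ?n = "card (pverts G)" and ?R = "\<lambda>i j. (f i, f j) \<in> parcs G"
  have "{..<?n} = insert i ({j. j < ?n \<and> (f i, f j) \<in> parcs G} \<union> non_nbrs ?n ?R i)"
    using ij by (auto simp: non_nbrs_def)
  also have "card \<dots> = Suc (card {j. j < ?n \<and> (f i, f j) \<in> parcs G} + card (non_nbrs ?n ?R i))"
  proof -
    have "card ({j. j < ?n \<and> (f i, f j) \<in> parcs G} \<union> non_nbrs ?n ?R i)
        = card {j. j < ?n \<and> (f i, f j) \<in> parcs G} + card (non_nbrs ?n ?R i)"
      by (intro card_Un_disjoint) (auto simp: non_nbrs_def)
    moreover have "i \<notin> {j. j < ?n \<and> (f i, f j) \<in> parcs G} \<union> non_nbrs ?n ?R i"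
      by (auto simp: non_nbrs_def)
    ultimately show ?thesis by simp
  qed
  finally show ?thesis
    using True ij
    by (simp add: laplacian_mat_def degree_mat_def adjacency_mat_def co_laplacian_def
        out_degree_enum[OF f])
next
  case False
  then show ?thesis
    using ij by (simp add: laplacian_mat_def degree_mat_def adjacency_mat_def co_laplacian_def)
qed

end

lemma char_poly_laplacian_eq_iff:
  assumes G: "pair_graph G" and H: "pair_graph H" and card: "card (pverts G) = n" "card (pverts H) = n"
    and f: "bij_betw f {..<n} (pverts G)" and g: "bij_betw g {..<n} (pverts H)"
  shows "char_poly (laplacian_mat f G) = char_poly (laplacian_mat g H) \<longleftrightarrow>
    char_poly (co_laplacian n (\<lambda>i j. (f i, f j) \<in> parcs G))
      = char_poly (co_laplacian n (\<lambda>i j. (g i, g j) \<in> parcs H))"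
  using laplacian_mat_carrier[of f G] laplacian_mat_carrier[of g H] f g card
    pair_graph.laplacian_mat_row_sum[OF G] pair_graph.laplacian_mat_row_sum[OF H]
    pair_graph.laplacian_mat_co_laplacian[OF G] pair_graph.laplacian_mat_co_laplacian[OF H]
  by (intro char_poly_complement_eq_iff) auto

text \<open>Another enumeration gives a similar Laplacian, and
  \<open>char_poly_laplacian_eq_iff\<close> carries this over to K without a second permutation
  argument.\<close>

lemma co_char_poly_enum:
  assumes G: "pair_graph G" and f: "bij_betw f {..<card (pverts G)} (pverts G)"
  shows "co_char_poly G = char_poly (co_laplacian (card (pverts G)) (\<lambda>i j. (f i, f j) \<in> parcs G))"
proof -
  interpret pair_graph G by fact
  have g: "bij_betw (from_nat_into (pverts G)) {..<card (pverts G)} (pverts G)"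
    by (intro bij_betw_from_nat_into_finite pair_finite_verts)
  show ?thesis
    unfolding co_char_poly_def char_poly_laplacian_eq_iff[OF G G refl refl g f, symmetric]
    by (intro char_poly_similar laplacian_mat_reindex g f)
qed

lemma degree_co_char_poly: "degree (co_char_poly G) = card (pverts G)"
  unfolding co_char_poly_def using degree_monic_char_poly[OF co_laplacian_carrier] by blast

lemma co_char_poly_nonzero: "co_char_poly G \<noteq> 0"
  unfolding co_char_poly_def using degree_monic_char_poly[OF co_laplacian_carrier]
  by (metis coeff_0 zero_neq_one)

text \<open>The complement identity compares graphs of equal order. For different orders both sides
  fail, by the degrees of the polynomials.\<close>

lemma L_cospectral_iff:
  assumes G: "pair_graph G" and H: "pair_graph H"
  shows "L_cospectral G H \<longleftrightarrow> co_char_poly G = co_char_poly H"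
proof -
  interpret G: pair_graph G by fact
  interpret H: pair_graph H by fact
  let ?f = "from_nat_into (pverts G)" and ?g = "from_nat_into (pverts H)"
  have f: "bij_betw ?f {..<card (pverts G)} (pverts G)"
    by (intro bij_betw_from_nat_into_finite G.pair_finite_verts)
  have g: "bij_betw ?g {..<card (pverts H)} (pverts H)"
    by (intro bij_betw_from_nat_into_finite H.pair_finite_verts)
  have *: "L_cospectral G H \<longleftrightarrow> char_poly (laplacian_mat ?f G) = char_poly (laplacian_mat ?g H)"
    unfolding L_cospectral_def laplacian_spectrum_def
    by (rule char_poly_eq_iff_proots_complex[OF laplacian_mat_carrier laplacian_mat_carrier])
  have deg: "degree (char_poly (laplacian_mat h F)) = card (pverts F)"
    for h and F :: "'c pair_pre_digraph"
    using degree_monic_char_poly[OF laplacian_mat_carrier] by blast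
  show ?thesis
  proof (cases "card (pverts G) = card (pverts H)")
    case True
    then show ?thesis
      using char_poly_laplacian_eq_iff[OF G H refl _ f, of ?g] g unfolding * co_char_poly_def by simp
  next
    case False
    then show ?thesis using deg degree_co_char_poly unfolding * by metis
  qed
qed

text \<open>A vertex of the complete graph is adjacent to all others in the join, hence isolated in
  the complement. With the vertices of \<open>G\<close> enumerated first, K only gains a zero block
  of size \<open>m\<close>.\<close>

lemma co_char_poly_join_complete:
  assumes G: "pair_graph G"
  shows "co_char_poly (graph_join G (complete_graph m)) = monom 1 m * co_char_poly G"
proof -
  interpret pair_graph G by fact
  obtain n where n: "card (pverts G) = n" by simp
  let ?J = "graph_join G (complete_graph m)"
  have J: "pair_graph ?J" by (intro pair_graph_graph_join G pair_graph_complete_graph)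
  obtain f where f: "bij_betw f {..<n} (pverts G)"
    using bij_betw_from_nat_into_finite[OF pair_finite_verts] n by blast
  then have f': "f i \<in> pverts G" if "i < n" for i using that by (auto simp: bij_betw_def)
  have verts: "pverts ?J = pverts G <+> {..<m}" by (simp add: graph_join_def complete_graph_def)
  then have card: "card (pverts ?J) = n + m" using pair_finite_verts n by (simp add: card_Plus)
  define h where "h i = (if i < n then Inl (f i) else Inr (i - n))" for i
  have "bij_betw h {..<n + m} (pverts ?J)"
    unfolding bij_betw_def
  proof
    show "inj_on h {..<n + m}"
      using f by (auto simp: inj_on_def h_def bij_betw_def split: if_splits)
    have "Inl u \<in> h ` {..<n + m}" if "u \<in> pverts G" for u
    proof -
      have "u \<in> f ` {..<n}" using f that by (simp add: bij_betw_def)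
      then obtain i where "i < n" "f i = u" by auto
      then show ?thesis by (intro image_eqI[of _ _ i]) (auto simp: h_def)
    qed
    moreover have "Inr j \<in> h ` {..<n + m}" if "j < m" for j
      using that by (intro image_eqI[of _ _ "n + j"]) (auto simp: h_def)
    ultimately show "h ` {..<n + m} = pverts ?J"
      unfolding verts using f' by (auto simp: h_def)
  qed
  then have h: "bij_betw h {..<card (pverts ?J)} (pverts ?J)" by (simp add: card)
  have arc: "(h i, h j) \<in> parcs ?J \<longleftrightarrow>
      (if i < n \<and> j < n then (f i, f j) \<in> parcs G else i \<noteq> j)" if "i < n + m" "j < n + m" for i j
    using that f' by (auto simp: h_def graph_join_def complete_graph_def)
  have non: "non_nbrs (n + m) (\<lambda>i j. (h i, h j) \<in> parcs ?J) i
      = (if i < n then non_nbrs n (\<lambda>i j. (f i, f j) \<in> parcs G) i else {})" if "i < n + m" for i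
    using arc that by (auto simp: non_nbrs_def split: if_splits)
  have "co_laplacian (n + m) (\<lambda>i j. (h i, h j) \<in> parcs ?J)
    = four_block_mat (co_laplacian n (\<lambda>i j. (f i, f j) \<in> parcs G)) (0\<^sub>m n m) (0\<^sub>m m n) (0\<^sub>m m m)"
    by (intro eq_matI) (auto simp: co_laplacian_def arc non)
  then show ?thesis
    unfolding co_char_poly_enum[OF J h] unfolding card
    using co_char_poly_enum[OF G, of f] f by (simp add: n char_poly_block_diag_zero)
qed

subsection \<open>Joins with a complete graph\<close>

definition delete_verts :: "'a set \<Rightarrow> 'a pair_pre_digraph \<Rightarrow> 'a pair_pre_digraph" where
  "delete_verts D G =
     \<lparr> pverts = pverts G - D, parcs = {(u, v) \<in> parcs G. u \<notin> D \<and> v \<notin> D} \<rparr>"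

lemma pair_graph_delete_verts:
  assumes "pair_graph G"
  shows "pair_graph (delete_verts D G)"
proof -
  interpret pair_graph G by fact
  show ?thesis
  proof unfold_locales
    fix e assume "e \<in> parcs (delete_verts D G)"
    then show "fst e \<in> pverts (delete_verts D G)" "snd e \<in> pverts (delete_verts D G)" "fst e \<noteq> snd e"
      by (auto simp: delete_verts_def dest: in_arcsD1 in_arcsD2)
  next
    show "finite (pverts (delete_verts D G))"
      using pair_finite_verts by (simp add: delete_verts_def)
    have "parcs (delete_verts D G) \<subseteq> parcs G" by (auto simp: delete_verts_def)
    then show "finite (parcs (delete_verts D G))"
      using pair_finite_arcs finite_subset by blast
    show "symmetric (with_proj (delete_verts D G))"
      using parcs_sym by (auto simp: symmetric_def sym_def delete_verts_def)
  qed
qed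

text \<open>Vertices adjacent to all others are pairwise adjacent, so they form a complete graph
  joined to the rest. Equality with a \<open>relabel\<close> copy serves both for spectra and for
  isomorphism.\<close>

lemma graph_join_complete_delete_verts:
  assumes G: "pair_graph G" and D: "D \<subseteq> pverts G" "card D = m"
    and dom: "\<And>d v. d \<in> D \<Longrightarrow> v \<in> pverts G \<Longrightarrow> v \<noteq> d \<Longrightarrow> (d, v) \<in> parcs G"
  obtains h where "inj_on h (pverts G)"
    "graph_join (delete_verts D G) (complete_graph m) = relabel h G"
proof -
  interpret pair_graph G by fact
  have "finite D" using D(1) pair_finite_verts finite_subset by blast
  then obtain k where k: "bij_betw k D {..<m}"
    using ex_bij_betw_finite_nat[of D] D(2) lessThan_atLeast0 by metis
  then have k_lt: "k d < m" and k_eq: "k d = k d' \<longleftrightarrow> d = d'" if "d \<in> D" "d' \<in> D" for d d'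
    using that by (auto simp: bij_betw_def inj_on_def)
  have k_surj: "\<exists>d\<in>D. k d = i" if "i < m" for i
    using k that unfolding bij_betw_def by (metis imageE lessThan_iff)
  define h where "h v = (if v \<in> D then Inr (k v) else Inl v)" for v
  let ?J = "graph_join (delete_verts D G) (complete_graph m)"
  have inj: "inj_on h (pverts G)"
    using k_eq by (auto simp: inj_on_def h_def)
  have verts: "pverts ?J = h ` pverts G"
  proof (intro equalityI subsetI)
    fix x assume "x \<in> pverts ?J"
    then consider v where "x = Inl v" "v \<in> pverts G" "v \<notin> D" | i where "x = Inr i" "i < m"
      by (auto simp: graph_join_def delete_verts_def complete_graph_def)
    then show "x \<in> h ` pverts G"
    proof cases
      case 1
      then show ?thesis by (intro image_eqI[of _ _ v]) (auto simp: h_def)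
    next
      case 2
      then obtain d where "d \<in> D" "k d = i" using k_surj by blast
      then show ?thesis using 2 D by (intro image_eqI[of _ _ d]) (auto simp: h_def)
    qed
  next
    fix x assume "x \<in> h ` pverts G"
    then show "x \<in> pverts ?J"
      using k_lt by (auto simp: graph_join_def delete_verts_def complete_graph_def h_def)
  qed
  have arc: "(h u, h v) \<in> parcs ?J \<longleftrightarrow> (u, v) \<in> parcs G"
    if uv: "u \<in> pverts G" "v \<in> pverts G" for u v
  proof (cases "u \<in> D \<or> v \<in> D")
    case False
    then show ?thesis using uv
      by (auto simp: graph_join_def delete_verts_def complete_graph_def h_def)
  next
    case True
    have "(u, v) \<in> parcs G \<longleftrightarrow> u \<noteq> v"
      using True dom[of u v] dom[of v u] uv parcs_sym by auto
    moreover have "(h u, h v) \<in> parcs ?J \<longleftrightarrow> u \<noteq> v"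
      using True uv k_lt k_eq
      by (auto simp: graph_join_def delete_verts_def complete_graph_def h_def split: if_splits)
    ultimately show ?thesis by simp
  qed
  have "parcs ?J = map_prod h h ` parcs G"
  proof (intro equalityI subsetI)
    fix e assume e: "e \<in> parcs ?J"
    interpret J: pair_graph ?J
      by (intro pair_graph_graph_join pair_graph_delete_verts G pair_graph_complete_graph)
    have "fst e \<in> h ` pverts G" "snd e \<in> h ` pverts G"
      using J.arc_fst_in_verts[OF e] J.arc_snd_in_verts[OF e] verts by auto
    then obtain u v where uv: "u \<in> pverts G" "v \<in> pverts G" "e = (h u, h v)"
      by (metis imageE prod.collapse)
    then have "(u, v) \<in> parcs G" using e arc by simp
    then show "e \<in> map_prod h h ` parcs G" using uv(3) by force
  next
    fix e assume "e \<in> map_prod h h ` parcs G"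
    then obtain u v where "(u, v) \<in> parcs G" "e = (h u, h v)" by auto
    then show "e \<in> parcs ?J" using arc in_arcsD1 in_arcsD2 by metis
  qed
  with verts have "?J = relabel h G" by (simp add: relabel_def)
  then show ?thesis using that inj by blast
qed

text \<open>A library isomorphism has a separate arc map. Since tails and heads in \<open>H\<close>
  are the components of pairs, the vertex map determines it.\<close>

lemma digraph_iso_imp_relabel:
  assumes G: "pair_graph G" and iso: "digraph_iso (with_proj G) (with_proj H)"
  obtains h where "inj_on h (pverts G)" "H = relabel h G"
proof -
  obtain f where f: "pre_digraph.digraph_isomorphism (with_proj G) f"
    and H: "with_proj H = app_iso f (with_proj G)"
    using iso unfolding digraph_iso_def by blast
  let ?h = "iso_verts f"
  have inj: "inj_on ?h (pverts G)"
    and ends: "\<And>a. a \<in> parcs G \<Longrightarrow> ?h (fst a) = iso_tail f (iso_arcs f a)"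
      "\<And>a. a \<in> parcs G \<Longrightarrow> ?h (snd a) = iso_head f (iso_arcs f a)"
    using f unfolding pre_digraph.digraph_isomorphism_def by auto
  have H': "pverts H = ?h ` pverts G" "parcs H = iso_arcs f ` parcs G"
    "iso_tail f = fst" "iso_head f = snd"
    using H by (auto simp: app_iso_def with_proj_def)
  have "iso_arcs f a = map_prod ?h ?h a" if "a \<in> parcs G" for a
    using ends[OF that] H'(3,4) by (cases a) (auto simp: prod_eq_iff)
  then have "parcs H = map_prod ?h ?h ` parcs G" using H'(2) by simp
  then have "H = relabel ?h G" using H'(1) by (simp add: relabel_def)
  then show ?thesis using that inj by blast
qed

lemma map_prod_image_Times: "map_prod f g ` (A \<times> B) = (f ` A) \<times> (g ` B)"
  by force

lemma graph_join_relabel: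
  "graph_join (relabel h G) H = relabel (map_sum h id) (graph_join G H)"
  by (simp add: graph_join_def relabel_def image_Un image_image Plus_def map_prod_image_Times
      map_prod.compositionality comp_def)

lemma digraph_iso_graph_join:
  assumes G: "pair_graph G" and H: "pair_graph H" and iso: "digraph_iso (with_proj G) (with_proj G')"
  shows "digraph_iso (with_proj (graph_join G H)) (with_proj (graph_join G' H))"
proof -
  obtain h where h: "inj_on h (pverts G)" "G' = relabel h G"
    using digraph_iso_imp_relabel[OF G iso] by blast
  have "inj_on (map_sum h id) (pverts (graph_join G H))"
  proof (rule inj_onI)
    fix x y
    assume "x \<in> pverts (graph_join G H)" "y \<in> pverts (graph_join G H)"
      "map_sum h id x = map_sum h id y"
    then show "x = y"
      using inj_onD[OF h(1)] by (cases x; cases y) (auto simp: graph_join_def)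
  qed
  then show ?thesis
    unfolding h(2) graph_join_relabel
    by (intro digraph_iso_relabel pair_graph_graph_join G H)
qed

subsection \<open>Leaves of trees\<close>

text \<open>The first vertex of a longest path has no neighbour except the second one.\<close>

lemma undirected_tree_leaf:
  assumes T: "undirected_tree T" and card: "card (pverts T) \<ge> 2"
  obtains v u where "(v, u) \<in> parcs T" "\<And>w. (v, w) \<in> parcs T \<Longrightarrow> w = u"
proof -
  interpret pair_graph T using T by (simp add: undirected_tree_def)
  have acyclic: "\<not> 3 \<le> length p" if "cycle p" for p
    using T that unfolding undirected_tree_def by blast
  obtain x y where xy: "x \<in> pverts T" "y \<in> pverts T" "x \<noteq> y"
    using card by (metis card_le_Suc0_iff_eq not_less_eq_eq numeral_2_eq_2 pair_finite_verts)
  have "connected (with_proj T)" using T by (simp add: undirected_tree_def)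
  then have "x \<rightarrow>\<^sup>*\<^bsub>with_proj (mk_symmetric (with_proj T))\<^esub> y"
    using xy by (simp add: connected_def strongly_connected_def)
  then have "x \<rightarrow>\<^sup>*\<^bsub>with_proj T\<^esub> y" using reachable_mk_symmetric_eq pair_sym_arcs by blast
  then obtain q where q: "awalk x q y" using reachable_awalk by blast
  \<comment> \<open>An arc exists, so a longest path is nonempty and its first vertex has a
    successor.\<close>
  then have "q \<noteq> []" using xy(3) by (auto simp: awalk_Nil_iff)
  then obtain a where a: "a \<in> parcs T" using q by (metis awalkE' hd_in_set subsetD)
  define P where "P l \<longleftrightarrow> (\<exists>u p v. apath u p v \<and> length p = l)" for l
  have bound: "l \<le> card (pverts T)" if "P l" for l
  proof -
    from that obtain u p v where p: "apath u p v" "length p = l" by (auto simp: P_def)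
    then have "distinct (pawalk_verts u p)" "set (pawalk_verts u p) \<subseteq> pverts T"
      by (auto simp: apath_def)
    then have "length (pawalk_verts u p) \<le> card (pverts T)"
      by (metis card_mono distinct_card pair_finite_verts)
    then show ?thesis using p(2) length_awalk_verts[of u p] by simp
  qed
  have "apath (fst a) [a] (snd a)"
    using a arc_fst_in_verts[OF a] arc_snd_in_verts[OF a] no_loops'[of "fst a" "snd a"]
    by (auto simp: apath_simps)
  then have P1: "P 1" unfolding P_def by (intro exI[of _ "fst a"] exI[of _ "[a]"] exI[of _ "snd a"]) simp
  define l where "l = (GREATEST l. P l)"
  have "P l" unfolding l_def by (rule GreatestI_nat[of P, OF P1 bound])
  then obtain v p z where p: "apath v p z" "length p = l" by (auto simp: P_def)
  have max: "length p' \<le> l" if "apath v' p' z'" for v' p' z'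
    unfolding l_def by (rule Greatest_le_nat[of P, OF _ bound]) (use that in \<open>auto simp: P_def\<close>)
  have "l \<ge> 1" unfolding l_def by (rule Greatest_le_nat[of P, OF P1 bound])
  then obtain e es where pe: "p = e # es" using p(2) by (cases p) auto
  then have e: "e \<in> parcs T" "fst e = v" using p(1) by (auto simp: apath_simps)
  have "w = snd e" if w: "(v, w) \<in> parcs T" for w
  proof (rule ccontr)
    assume neq: "w \<noteq> snd e"
    have wv: "(w, v) \<in> parcs T" "w \<noteq> v" using w parcs_sym no_loops' by auto
    show False
    \<comment> \<open>A \<open>w\<close> off the path would extend it at the front; a
      \<open>w\<close> on the path closes a cycle with the segment \<open>q\<close> from
      \<open>v\<close> to \<open>w\<close>.\<close>
    proof (cases "w \<in> set (pawalk_verts v p)")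
      case False
      then have "apath w ((w, v) # p) z" using p(1) wv by (auto simp: apath_simps)
      then show False using max[of w "(w, v) # p" z] p(2) by simp
    next
      case True
      have walk: "awalk v p z" "distinct (pawalk_verts v p)" using p(1) by (auto simp: apath_def)
      obtain q r where qr: "p = q @ r" "awalk v q w" "awalk w r z"
        using awalk_decomp[OF walk(1) True] by blast
      have "apath v q w"
        using p(1) qr(2) unfolding qr(1) by (auto simp: apath_append_iff)
      then have dist: "distinct (pawalk_verts v q)" by (simp add: apath_def)
      have "awalk v (q @ [(w, v)]) v"
        by (rule awalk_appendI[OF qr(2)]) (use wv in \<open>auto simp: awalk_simps in_arcsD2\<close>)
      moreover have vs: "pawalk_verts v (q @ [(w, v)]) = pawalk_verts v q @ [v]"
        using awalk_verts_append[OF calculation] qr(2) by simp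
      moreover have "hd (pawalk_verts v q) = v" using qr(2) by auto
      then have "distinct (tl (pawalk_verts v (q @ [(w, v)])))"
        unfolding vs using dist by (cases "pawalk_verts v q") auto
      ultimately have "cycle (q @ [(w, v)])" unfolding cycle_def by blast
      \<comment> \<open>Only cycles of length at least 3 are excluded, so \<open>q\<close> needs two
        arcs: an empty \<open>q\<close> would give w = v, and q = [e] would give w = snd e.\<close>
      moreover have "length q \<ge> 2"
      proof (rule ccontr)
        assume "\<not> 2 \<le> length q"
        then consider "q = []" | "q = [e]"
          using qr(1) pe by (cases q; cases "tl q") auto
        then show False using qr(2) wv neq by cases (auto simp: awalk_simps)
      qed
      ultimately show False using acyclic by fastforce
    qed
  qed
  moreover have "(v, snd e) \<in> parcs T" using e by (metis prod.collapse)
  ultimately show ?thesis using that by blast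
qed

text \<open>
  The test vector is \<open>n - 2\<close> at the pendant vertex, \<open>0\<close> at its neighbour and \<open>- 1\<close> elsewhere; in the
  complement of a star it is an eigenvector for the eigenvalue \<open>n - 1\<close>.
\<close>

lemma co_laplacian_pendant_eigenvalue:
  assumes sym: "\<And>i j. i < n \<Longrightarrow> j < n \<Longrightarrow> R i j = R j i"
    and n: "n \<ge> 3" and v: "v < n" and u: "u < n" and uv: "u \<noteq> v" "R v u"
    and pend: "\<And>j. j < n \<Longrightarrow> R v j \<Longrightarrow> j = u"
  shows "\<exists>e. e > real n - 2 \<and> poly (char_poly (co_laplacian n R)) e = 0"
    and "non_nbrs n R u \<noteq> {} \<Longrightarrow> \<exists>e. e > real n - 1 \<and> poly (char_poly (co_laplacian n R)) e = 0"
proof -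
  let ?K = "co_laplacian n R"
  define x where "x = vec n (\<lambda>i. if i = v then real n - 2 else if i = u then 0 else - 1 :: real)"
  have x: "x \<in> carrier_vec n" by (simp add: x_def)
  define W where "W = {..<n} - {u, v}"
  \<comment> \<open>The number of vertices other than \<open>u\<close> and \<open>v\<close> not
    adjacent to \<open>u\<close>. It measures the deviation from a universal \<open>u\<close> and is
    exactly the excess of x . K x over (n - 1)(x . x).\<close>
  define q where "q = (\<Sum>i\<in>W. of_bool (u \<in> non_nbrs n R i) :: real)"
  have split: "sum F {..<n} = F v + (F u + sum F W)" for F :: "nat \<Rightarrow> real"
  proof -
    have "{..<n} = insert v (insert u W)" "v \<notin> insert u W" "u \<notin> W" "finite W"
      using u v uv by (auto simp: W_def)
    then show ?thesis by simp
  qed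
  have cW: "real (card W) = real n - 2"
    using u v uv n by (simp add: W_def card_Diff_subset of_nat_diff)
  have xv: "x $ v = real n - 2" "x $ u = 0" "\<And>i. i \<in> W \<Longrightarrow> x $ i = - 1"
    using u v uv by (auto simp: x_def W_def)
  have Kv: "(?K *\<^sub>v x) $ v = (real n - 2) * (real n - 1)"
  proof -
    have "non_nbrs n R v = W" unfolding non_nbrs_def W_def using pend uv u by blast
    then show ?thesis
      by (simp add: co_laplacian_mult_vec[OF x v] xv cW)
  qed
  have KW: "(?K *\<^sub>v x) $ i = - (real n - 1) - of_bool (u \<in> non_nbrs n R i)" if i: "i \<in> W" for i
  proof -
    have i': "i < n" "i \<noteq> u" "i \<noteq> v" using i by (auto simp: W_def)
    have vi: "v \<in> non_nbrs n R i" using i' pend[OF i'(1)] sym[OF i'(1) v] v by (auto simp: non_nbrs_def)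
    have "(?K *\<^sub>v x) $ i = (\<Sum>l\<in>{..<n} \<inter> non_nbrs n R i. x $ i - x $ l)"
      unfolding co_laplacian_mult_vec[OF x i'(1)] by (intro sum.cong) (auto simp: non_nbrs_def)
    also have "\<dots> = (\<Sum>l<n. of_bool (l \<in> non_nbrs n R i) * (x $ i - x $ l))"
      by (simp add: sum.inter_restrict of_bool_def if_distrib[of "\<lambda>x. x * _"] cong: if_cong)
    also have "\<dots> = - (real n - 1) - of_bool (u \<in> non_nbrs n R i)"
      unfolding split using vi i by (simp add: xv)
    finally show ?thesis .
  qed
  have xKx: "x \<bullet> (?K *\<^sub>v x) = (real n - 2) * (real n - 1)\<^sup>2 + q"
  proof -
    have "x \<bullet> (?K *\<^sub>v x) = (\<Sum>i<n. x $ i * (?K *\<^sub>v x) $ i)"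
      by (simp add: scalar_prod_def lessThan_atLeast0 co_laplacian_def)
    also have "\<dots> = (real n - 2) * ((real n - 2) * (real n - 1)) + (\<Sum>i\<in>W. real n - 1 + of_bool (u \<in> non_nbrs n R i))"
    proof -
      have "(\<Sum>i\<in>W. x $ i * (?K *\<^sub>v x) $ i) = (\<Sum>i\<in>W. real n - 1 + of_bool (u \<in> non_nbrs n R i))"
        by (intro sum.cong refl) (simp add: xv KW)
      then show ?thesis unfolding split by (simp add: xv Kv)
    qed
    also have "\<dots> = (real n - 2) * ((real n - 2) * (real n - 1)) + ((real n - 2) * (real n - 1) + q)"
      unfolding sum.distrib q_def by (simp add: cW)
    finally show ?thesis by (simp add: power2_eq_square algebra_simps)
  qed
  have xx: "x \<bullet> x = (real n - 2) * (real n - 1)"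
  proof -
    have "x \<bullet> x = (\<Sum>i<n. x $ i * x $ i)"
      by (simp add: scalar_prod_def lessThan_atLeast0 x_def)
    also have "\<dots> = (real n - 2) * (real n - 2) + (real n - 2)"
      unfolding split by (simp add: xv cW cong: sum.cong)
    finally show ?thesis by (simp add: algebra_simps)
  qed
  have q0: "q \<ge> 0" by (simp add: q_def sum_nonneg)
  \<comment> \<open>Strict because x . x = (n - 2)(n - 1) is positive for
    \<open>n \<ge> 3\<close>.\<close>
  have gt2: "(real n - 2) * (x \<bullet> x) < x \<bullet> (?K *\<^sub>v x)"
  proof -
    have "(real n - 2) * (real n - 1) * (real n - 2) < (real n - 2) * (real n - 1) * (real n - 1)"
      using n by (intro mult_strict_left_mono) auto
    then show ?thesis using q0 by (simp add: xx xKx power2_eq_square mult_ac)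
  qed
  show "\<exists>e. e > real n - 2 \<and> poly (char_poly ?K) e = 0"
    by (rule symmetric_eigenvalue_gt[OF co_laplacian_carrier transpose_co_laplacian[OF sym] x gt2]) auto
  assume "non_nbrs n R u \<noteq> {}"
  then obtain i where "i < n" "i \<noteq> u" "\<not> R u i" by (auto simp: non_nbrs_def)
  then have i: "i \<in> W" "u \<in> non_nbrs n R i"
    using uv u sym[OF u v] sym[OF u, of i] by (auto simp: non_nbrs_def W_def)
  have "q > 0" unfolding q_def by (rule sum_pos2[of _ i]) (use i in \<open>auto simp: W_def\<close>)
  then have gt1: "(real n - 1) * (x \<bullet> x) < x \<bullet> (?K *\<^sub>v x)"
    by (simp add: xx xKx power2_eq_square mult_ac)
  show "\<exists>e. e > real n - 1 \<and> poly (char_poly ?K) e = 0"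
    by (rule symmetric_eigenvalue_gt[OF co_laplacian_carrier transpose_co_laplacian[OF sym] x gt1]) auto
qed

subsection \<open>Universal vertices\<close>

text \<open>The all-ones vector lies in the kernel of K.\<close>

lemma order_co_char_poly_pos:
  assumes G: "pair_graph G" and ne: "pverts G \<noteq> {}"
  shows "0 < Polynomial.order 0 (co_char_poly G)"
proof -
  interpret pair_graph G by fact
  let ?n = "card (pverts G)"
  let ?K = "co_laplacian ?n (\<lambda>i j. (from_nat_into (pverts G) i, from_nat_into (pverts G) j) \<in> parcs G)"
  have n: "0 < ?n" using ne pair_finite_verts by (simp add: card_gt_0_iff)
  let ?one = "vec ?n (\<lambda>_. 1 :: real)"
  have "?K *\<^sub>v ?one = 0 \<cdot>\<^sub>v ?one"
  proof (rule eq_vecI)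
    fix i assume "i < dim_vec (0 \<cdot>\<^sub>v ?one)"
    then have i: "i < ?n" by simp
    have "(?K *\<^sub>v ?one) $ i
        = (\<Sum>l\<in>non_nbrs ?n (\<lambda>i j. (from_nat_into (pverts G) i, from_nat_into (pverts G) j) \<in> parcs G) i.
            ?one $ i - ?one $ l)"
      by (rule co_laplacian_mult_vec[OF _ i]) simp
    also have "\<dots> = 0" using i by (intro sum.neutral) (auto simp: non_nbrs_def)
    finally show "(?K *\<^sub>v ?one) $ i = (0 \<cdot>\<^sub>v ?one) $ i" using i by simp
  qed (simp add: co_laplacian_def)
  moreover have "?one \<noteq> 0\<^sub>v ?n"
  proof
    assume "?one = 0\<^sub>v ?n"
    then have "?one $ 0 = 0\<^sub>v ?n $ 0" by simp
    then show False using n by simp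
  qed
  ultimately have "eigenvalue ?K 0"
    unfolding eigenvalue_def eigenvector_def by (intro exI[of _ ?one]) (simp add: co_laplacian_def)
  then have "poly (co_char_poly G) 0 = 0"
    unfolding co_char_poly_def by (simp add: eigenvalue_root_char_poly[OF co_laplacian_carrier])
  then show ?thesis using co_char_poly_nonzero[of G] by (simp add: order_root)
qed

lemma order_co_char_poly_join_complete:
  assumes "pair_graph G"
  shows "Polynomial.order 0 (co_char_poly (graph_join G (complete_graph m)))
    = m + Polynomial.order 0 (co_char_poly G)"
  using co_char_poly_nonzero[of G] order_power_n_n[of "0 :: real" m]
  by (simp add: co_char_poly_join_complete[OF assms] order_mult monom_altdef)

lemma co_char_poly_relabel:
  assumes "pair_graph G" "inj_on h (pverts G)"
  shows "co_char_poly (relabel h G) = co_char_poly G"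
  using L_cospectral_relabel[OF assms] L_cospectral_iff[OF pair_graph_relabel[OF assms] assms(1)]
  by simp

text \<open>
  The witness is \<open>j = 1\<close> for stars with at least two vertices, where the neighbour of a leaf is
  universal, and \<open>j = 0\<close> otherwise.
\<close>

lemma undirected_tree_co_spectrum:
  assumes T: "undirected_tree T"
  obtains j where "j < Polynomial.order 0 (co_char_poly T)"
    "card (pverts T) \<le> j + 1 \<or>
      (\<exists>e. e > real (card (pverts T)) - real j - 1 \<and> poly (co_char_poly T) e = 0)"
proof -
  interpret pair_graph T using T by (simp add: undirected_tree_def)
  have G: "pair_graph T" by unfold_locales
  obtain n where n: "card (pverts T) = n" by simp
  have ne: "pverts T \<noteq> {}"
    using T by (simp add: undirected_tree_def connected_def strongly_connected_def)
  note pos = order_co_char_poly_pos[OF G ne]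
  show ?thesis
  proof (cases "n \<le> 1")
    case True
    then show ?thesis using that[OF pos] n by simp
  next
    case False
    then have "card (pverts T) \<ge> 2" using n by simp
    then obtain v u where vu: "(v, u) \<in> parcs T" and pend: "\<And>w. (v, w) \<in> parcs T \<Longrightarrow> w = u"
      using undirected_tree_leaf[OF T] by metis
    have verts: "v \<in> pverts T" "u \<in> pverts T" "u \<noteq> v"
      using vu in_arcsD1 in_arcsD2 parcs_irrefl by metis+
    obtain f where f: "bij_betw f {..<n} (pverts T)"
      using bij_betw_from_nat_into_finite[OF pair_finite_verts] n by blast
    then have f_eq: "f i = f j \<longleftrightarrow> i = j" if "i < n" "j < n" for i j
      using that by (auto simp: bij_betw_def inj_on_def)
    have surj: "\<exists>i<n. f i = w" if "w \<in> pverts T" for w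
      using f that unfolding bij_betw_def by (metis imageE lessThan_iff)
    obtain i0 i1 where i: "i0 < n" "f i0 = v" "i1 < n" "f i1 = u" using surj verts by metis
    define R where "R i j \<longleftrightarrow> (f i, f j) \<in> parcs T" for i j
    have cp: "co_char_poly T = char_poly (co_laplacian n R)"
      using co_char_poly_enum[OF G, of f] f n by (simp add: R_def[abs_def])
    have symR: "R i j = R j i" for i j using parcs_sym by (simp add: R_def)
    have neq: "i1 \<noteq> i0" using i verts(3) by auto
    have R: "R i0 i1" using vu i by (simp add: R_def)
    have pendR: "j = i1" if "j < n" "R i0 j" for j
      using pend[of "f j"] that i f_eq by (simp add: R_def)
    note pendant = co_laplacian_pendant_eigenvalue[OF symR _ i(1) i(3) neq R]
    show ?thesis
    proof (cases "non_nbrs n R i1 = {}")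
      case True
      \<comment> \<open>Here \<open>u\<close> is universal, so \<open>T\<close> is the join of T - u
        with one vertex. One zero eigenvalue comes from the join and a second from T - u, which
        contains \<open>v\<close>.\<close>
      have dom: "(u, w) \<in> parcs T" if w: "w \<in> pverts T" "w \<noteq> u" for w
      proof -
        obtain l where "l < n" "f l = w" using surj[OF w(1)] by blast
        then show ?thesis using True w(2) i by (auto simp: non_nbrs_def R_def)
      qed
      have "{u} \<subseteq> pverts T" "card {u} = 1" using verts by auto
      then obtain h where h: "inj_on h (pverts T)"
        "graph_join (delete_verts {u} T) (complete_graph 1) = relabel h T"
        using graph_join_complete_delete_verts[OF G, of "{u}" 1] dom by blast
      have D: "pair_graph (delete_verts {u} T)" by (rule pair_graph_delete_verts[OF G])
      have "pverts (delete_verts {u} T) \<noteq> {}" using verts by (auto simp: delete_verts_def)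
      then have "1 < Polynomial.order 0 (co_char_poly (relabel h T))"
        using order_co_char_poly_pos[OF D] order_co_char_poly_join_complete[OF D, of 1] h(2) by simp
      then have "1 < Polynomial.order 0 (co_char_poly T)"
        by (simp add: co_char_poly_relabel[OF G h(1)])
      \<comment> \<open>For n = 2 the first alternative holds; the test vector is used for
        \<open>n \<ge> 3\<close>.\<close>
      moreover have "n \<le> 1 + 1 \<or> (\<exists>e. e > real n - real 1 - 1 \<and> poly (co_char_poly T) e = 0)"
      proof (cases "n \<ge> 3")
        case True
        then have "\<exists>e. e > real n - 2 \<and> poly (co_char_poly T) e = 0"
          unfolding cp by (rule pendant(1)) (rule pendR)
        then show ?thesis by simp
      qed simp
      ultimately show ?thesis using that[of 1] by (simp only: n)
    next
      case False
      \<comment> \<open>A vertex not adjacent to \<open>u\<close> is a third vertex besides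
        \<open>u\<close> and \<open>v\<close>, so the stronger eigenvalue bound is
        available.\<close>
      then obtain l where "l < n" "l \<noteq> i1" "\<not> R i1 l" by (auto simp: non_nbrs_def)
      moreover have "l \<noteq> i0" using calculation R symR by auto
      ultimately have "card {l, i0, i1} \<le> card {..<n}" "card {l, i0, i1} = 3"
        using i neq by (auto intro!: card_mono)
      then have "n \<ge> 3" by simp
      then have "\<exists>e. e > real n - 1 \<and> poly (co_char_poly T) e = 0"
        unfolding cp by (rule pendant(2)) (rule pendR, assumption+, rule False)
      then show ?thesis using that[OF pos] by (simp add: n)
    qed
  qed
qed

text \<open>This reads \<open>card_dominating_ge\<close> in the graph: a vertex isolated in the
  complement is adjacent to all others. Exactly \<open>k\<close> of them are selected.\<close>

lemma universal_vertices_exist: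
  assumes G: "pair_graph G" and ord: "k < Polynomial.order 0 (co_char_poly G)"
    and ev: "card (pverts G) \<le> k + 1 \<or>
      (\<exists>e. e > real (card (pverts G)) - real k - 1 \<and> poly (co_char_poly G) e = 0)"
  obtains D where "D \<subseteq> pverts G" "card D = k"
    "\<And>d v. d \<in> D \<Longrightarrow> v \<in> pverts G \<Longrightarrow> v \<noteq> d \<Longrightarrow> (d, v) \<in> parcs G"
proof -
  interpret pair_graph G by fact
  obtain n where n: "card (pverts G) = n" by simp
  obtain f where f: "bij_betw f {..<n} (pverts G)"
    using bij_betw_from_nat_into_finite[OF pair_finite_verts] n by blast
  define R where "R i j \<longleftrightarrow> (f i, f j) \<in> parcs G" for i j
  have cp: "co_char_poly G = char_poly (co_laplacian n R)"
    using co_char_poly_enum[OF G, of f] f n by (simp add: R_def[abs_def])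
  define I where "I = {i. i < n \<and> non_nbrs n R i = {}}"
  have "R i j = R j i" for i j using parcs_sym by (simp add: R_def)
  then have "k \<le> card I"
    unfolding I_def using ord ev by (intro card_dominating_ge) (simp_all add: cp n)
  moreover have inj: "inj_on f I"
    using f by (auto simp: I_def bij_betw_def inj_on_def)
  ultimately obtain D where D: "D \<subseteq> f ` I" "card D = k"
    by (metis card_image obtain_subset_with_card_n)
  have I: "f ` I \<subseteq> pverts G" using f by (auto simp: I_def bij_betw_def)
  have "(d, v) \<in> parcs G" if dv: "d \<in> D" "v \<in> pverts G" "v \<noteq> d" for d v
  proof -
    obtain i where i: "i \<in> I" "d = f i" using dv D by auto
    have "v \<in> f ` {..<n}" using f dv by (simp add: bij_betw_def)
    then obtain j where j: "j < n" "v = f j" by auto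
    then have "j \<noteq> i" using dv i by auto
    then show ?thesis using i j by (auto simp: I_def non_nbrs_def R_def)
  qed
  then show ?thesis using that[of D] D I by blast
qed

section \<open>Recovering the tree from a graph cospectral with the join\<close>

theorem mainTheorem1:
  fixes T :: "'a pair_pre_digraph" and m :: nat
  assumes "undirected_tree T"
    and "L_DS T"
    and "m \<ge> 1"
  shows "L_DS (graph_join T (complete_graph m))"
  unfolding L_DS_def
proof (intro allI impI)
  fix H :: "nat pair_pre_digraph"
  let ?K = "complete_graph m"
  assume "pair_graph H \<and> L_cospectral H (graph_join T ?K)"
  then have H: "pair_graph H" and cosp: "L_cospectral H (graph_join T ?K)" by auto
  have T: "pair_graph T" using assms(1) by (simp add: undirected_tree_def)
  have TK: "pair_graph (graph_join T ?K)"
    by (intro pair_graph_graph_join T pair_graph_complete_graph)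
  have cp: "co_char_poly H = co_char_poly (graph_join T ?K)"
    using cosp L_cospectral_iff[OF H TK] by simp
  then have cp': "co_char_poly H = monom 1 m * co_char_poly T"
    by (simp add: co_char_poly_join_complete[OF T])
  have card: "card (pverts H) = card (pverts T) + m"
    using degree_co_char_poly[of H] degree_co_char_poly[of T] co_char_poly_nonzero[of T]
    by (simp add: cp' degree_mult_eq degree_monom_eq)
  obtain j where j: "j < Polynomial.order 0 (co_char_poly T)"
    "card (pverts T) \<le> j + 1 \<or>
      (\<exists>e. e > real (card (pverts T)) - real j - 1 \<and> poly (co_char_poly T) e = 0)"
    by (rule undirected_tree_co_spectrum[OF assms(1)])
  \<comment> \<open>The join adds \<open>m\<close> both to the order and to the multiplicity of 0,
    so with \<open>m + j\<close> in place of \<open>j\<close> the bound on \<open>e\<close> is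
    unchanged, and \<open>e\<close> remains a root.\<close>
  have "m + j < Polynomial.order 0 (co_char_poly H)"
    using j(1) order_co_char_poly_join_complete[OF T, of m] by (simp add: cp)
  moreover have "card (pverts H) \<le> m + j + 1 \<or>
      (\<exists>e. e > real (card (pverts H)) - real (m + j) - 1 \<and> poly (co_char_poly H) e = 0)"
    using j(2) by (auto simp: card cp')
  ultimately obtain D' where D': "D' \<subseteq> pverts H" "card D' = m + j"
    "\<And>d v. d \<in> D' \<Longrightarrow> v \<in> pverts H \<Longrightarrow> v \<noteq> d \<Longrightarrow> (d, v) \<in> parcs H"
    by (rule universal_vertices_exist[OF H]) (rule that)
  \<comment> \<open>Only \<open>m\<close> of the \<open>m + j\<close> vertices are removed, so that
    the remaining graph has as many vertices as \<open>T\<close>.\<close>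
  obtain D where D: "D \<subseteq> D'" "card D = m"
    using obtain_subset_with_card_n[of m D'] D'(2) by auto
  have D_sub: "D \<subseteq> pverts H"
    and D_dom: "\<And>d v. d \<in> D \<Longrightarrow> v \<in> pverts H \<Longrightarrow> v \<noteq> d \<Longrightarrow> (d, v) \<in> parcs H"
    using D(1) D'(1,3) by auto
  let ?H' = "delete_verts D H"
  have H': "pair_graph ?H'" by (rule pair_graph_delete_verts[OF H])
  obtain h where h: "inj_on h (pverts H)" "graph_join ?H' ?K = relabel h H"
    using graph_join_complete_delete_verts[OF H D_sub D(2) D_dom] by blast
  \<comment> \<open>Joining the remaining graph with the complete graph gives back \<open>H\<close>
    up to \<open>relabel\<close>, so both sides equal \<open>co_char_poly H\<close>.\<close>
  have "monom 1 m * co_char_poly ?H' = monom 1 m * co_char_poly T"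
    using co_char_poly_join_complete[OF H', of m] co_char_poly_relabel[OF H h(1)]
    by (simp add: h(2) cp')
  then have "co_char_poly ?H' = co_char_poly T" by (simp add: monom_eq_0_iff)
  then have "L_cospectral ?H' T" using L_cospectral_iff[OF H' T] by simp
  then have "digraph_iso (with_proj ?H') (with_proj T)"
    using assms(2) H' by (simp add: L_DS_def)
  then have "digraph_iso (with_proj (graph_join ?H' ?K)) (with_proj (graph_join T ?K))"
    by (intro digraph_iso_graph_join H' pair_graph_complete_graph)
  moreover have "digraph_iso (with_proj H) (with_proj (graph_join ?H' ?K))"
    using digraph_iso_relabel[OF H h(1)] by (simp add: h(2))
  ultimately show "digraph_iso (with_proj H) (with_proj (graph_join T ?K))"
    by (rule digraph_iso_trans[rotated])
qed

end
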